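(* Assume (F1), (F2), (H1), (H2). Then for each $c>c^*$, the travelling wave problem with speed $c$ admits a solution $\phi$ satisfying $0<\phi(\xi)<K$ and $\phi'(\xi)>0$ for all $\xi\in\mathbb{R}$, and $$\lim_{\xi\to-\infty}\phi(\xi)e^{-\lambda\xi}=1,\qquad \lim_{\xi\to-\infty}\phi'(\xi)e^{-\lambda\xi}=\lambda,$$ where $\lambda=\lambda_1(c)$ is the smallest positive zero of $\Delta(c,\cdot)$.
   Context: Fix constants $d>0$, $\tau\geq0$, $K>0$, $f:[0,K]^2\to\mathbb{R}$ and $h:\mathbb{R}\to\mathbb{R}$ (partial derivatives of $f$ assumed to exist). (F1) $f\in C([0,K]^2,\mathbb{R})$, $f(0,0)=f(K,K)=0$, $f(u,u)>0$ for $u\in(0,K)$, $\partial_2f(u,v)\geq0$ on $[0,K]^2$. (F2) There exist $M>0$, $\sigma\in(0,1]$ with $0\leq \partial_1f(0,0)u+\partial_2f(0,0)v-f(u,v)\leq M(u+v)^{1+\sigma}$ on $[0,K]^2$, and $\partial_1f(K,K)+\partial_2f(K,K)<0$. (H1) $h\ge0$, even, integrable, $\int_{\mathbb{R}}h=1$. (H2) There is $\lambda_0\in(0,\infty]$ with $\int_0^\infty h(x)e^{\lambda x}dx<\infty$ for all $\lambda<\lambda_0$. Let $G(\lambda)=\int_{\mathbb{R}}h(y)e^{-\lambda y}dy$, $\lambda^+=\lambda_0$ if $\partial_2f(0,0)>0$ and $\lambda^+=+\infty$ otherwise, and $\Delta(c,\lambda)=c\lambda-d[e^{\lambda}+e^{-\lambda}-2]-\partial_1f(0,0)-\partial_2f(0,0)e^{-\lambda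 c\tau}G(\lambda)$. Let $c^*>0$ be the unique number for which there is $\lambda^*\in(0,\lambda^+)$ with $\Delta(c^*,\lambda^* )=0=\partial_\lambda\Delta(c^*,\lambda^* )$. Notation: $\Delta_1\phi(\xi)=\phi(\xi+1)-2\phi(\xi)+\phi(\xi-1)$, $(h*\phi)(\xi)=\int h(y)\phi(\xi-y)dy$. The travelling wave problem with speed $c>0$: find differentiable $\phi:\mathbb{R}\to\mathbb{R}$ with $-c\phi'(\xi)+d\Delta_1\phi(\xi)+f(\phi(\xi),(h*\phi)(\xi-c\tau))=0$ for all $\xi$, $\phi(-\infty)=0$, $\phi(+\infty)=K$, $0\le\phi\le K$. *)

theory Defs
  imports "HOL-Analysis.Analysis"
begin

definition kernelG :: "(real \<Rightarrow> real) \<Rightarrow> real \<Rightarrow> real" where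
  "kernelG h l = integral UNIV (\<lambda>y. h y * exp (- l * y))"

text \<open>Characteristic function Delta(c,lambda); a = partial_1 f(0,0), b = partial_2 f(0,0).\<close>
definition charDelta :: "real \<Rightarrow> real \<Rightarrow> real \<Rightarrow> real \<Rightarrow> (real \<Rightarrow> real) \<Rightarrow> real \<Rightarrow> real \<Rightarrow> real" where
  "charDelta d tau a b h c l =
     c * l - d * (exp l + exp (- l) - 2) - a - b * exp (- l * c * tau) * kernelG h l"

definition lambda_plus :: "real \<Rightarrow> ereal \<Rightarrow> ereal" where
  "lambda_plus b lambda0 = (if b > 0 then lambda0 else PInfty)"

definition dlap :: "(real \<Rightarrow> real) \<Rightarrow> real \<Rightarrow> real" where
  "dlap \<phi> \<xi> = \<phi> (\<xi> + 1) - 2 * \<phi> \<xi> + \<phi> (\<xi> - 1)"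

definition conv :: "(real \<Rightarrow> real) \<Rightarrow> (real \<Rightarrow> real) \<Rightarrow> real \<Rightarrow> real" where
  "conv h \<phi> \<xi> = integral UNIV (\<lambda>y. h y * \<phi> (\<xi> - y))"

definition travelling_wave ::
  "real \<Rightarrow> real \<Rightarrow> real \<Rightarrow> (real \<Rightarrow> real \<Rightarrow> real) \<Rightarrow> (real \<Rightarrow> real) \<Rightarrow> real \<Rightarrow> (real \<Rightarrow> real) \<Rightarrow> bool" where
  "travelling_wave d tau K f h c \<phi> \<longleftrightarrow>
     (\<forall>\<xi>. \<phi> differentiable at \<xi>) \<and>
     (\<forall>\<xi>. - c * deriv \<phi> \<xi> + d * dlap \<phi> \<xi> + f (\<phi> \<xi>) (conv h \<phi> (\<xi> - c * tau)) = 0) \<and>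
     (\<phi> \<longlongrightarrow> 0) at_bot \<and> (\<phi> \<longlongrightarrow> K) at_top \<and>
     (\<forall>\<xi>. 0 \<le> \<phi> \<xi> \<and> \<phi> \<xi> \<le> K)"

end

(* Idea. Let l = lambda_1(c) and l < mu < min (lambda^* ) ((1 + sigma) l). Then exp (l x) is a
   supersolution and chi x = exp (l x) - q exp (mu x), with q large, is a subsolution of the wave
   equation, because concavity of Delta(c, .) gives Delta(c, mu) > 0. As f need not be Lipschitz in
   u, replace it by its inf-convolutions f_n(u, v) = inf_w (f(w, v) + n |u - w|), which increase to
   f and keep the linear upper bound and, for large n, the lower bound of (F2). For f_n the equation
   is a fixed point problem for a monotone integral operator, and the infimum of all supersolutions
   between chi and exp (l x) is a solution phi_n. These are increasing in n and equi-Lipschitz, so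
   their limit is a wave for f. Being squeezed between chi and exp (l x), it has the asserted
   asymptotics, and a zero of phi' would propagate to the left and contradict them. *)
theory Submission
  imports Defs
begin

section \<open>Linear comparison\<close>

text \<open>The equation becomes a fixed point problem for an order preserving operator once a
  multiple of the unknown is added to both sides. This needs f(u, v) + N u to be nondecreasing in u
  for some N, and nothing bounds the partial derivative in u from below. Inf-convolution supplies
  such an N without losing the barriers: it lies below f, so the linear upper bound survives, and
  above every minorant of f that is n-Lipschitz in u, in particular a u + b v - M (u + b v)^(1 +
  sigma) for large n. The constants N_n blow up; bounds that must be uniform in n are therefore
  taken from the equation itself, where only the supremum of |f| enters. Minimality of phi_n is what
  makes the sequence monotone, because phi_(n+1) is a supersolution for f_n; so no subsequence has
  to be chosen. The power in (F2) is rewritten in terms of u + b v: only b times the convolution is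
  controlled by exponentials, since for b = 0 the exponential moments of h may diverge.\<close>

lemma nondecreasing_of_deriv_nonneg:
  fixes z :: "real \<Rightarrow> real"
  assumes "\<And>x. x \<le> b \<Longrightarrow> (z has_real_derivative z' x) (at x)" "\<And>x. x \<le> b \<Longrightarrow> z' x \<ge> 0"
    and "x \<le> y" "y \<le> b"
  shows "z x \<le> z y"
  using assms by (intro DERIV_nonneg_imp_nondecreasing[OF \<open>x \<le> y\<close>]) (metis order_trans)

text \<open>The weight exp (k x) makes z nondecreasing, and it vanishes at minus infinity while z stays
  bounded below.\<close>
lemma linear_comparison:
  fixes z :: "real \<Rightarrow> real"
  assumes c: "c > 0" and \<beta>: "\<beta> > 0"
    and der: "\<And>x. x \<le> b \<Longrightarrow> (z has_real_derivative z' x) (at x)"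
    and ineq: "\<And>x. x \<le> b \<Longrightarrow> c * z' x + \<beta> * z x \<ge> 0"
    and bdd: "\<And>x. x \<le> b \<Longrightarrow> z x \<ge> - B"
    and x: "x \<le> b"
  shows "z x \<ge> 0"
proof -
  define k where "k = \<beta> / c"
  have k: "k > 0" using c \<beta> by (simp add: k_def)
  define w where "w = (\<lambda>x. z x * exp (k * x))"
  have w_mono: "w s \<le> w t" if "s \<le> t" "t \<le> b" for s t
  proof (rule nondecreasing_of_deriv_nonneg[OF _ _ that])
    fix y assume y: "y \<le> b"
    show "(w has_real_derivative (z' y + k * z y) * exp (k * y)) (at y)"
      unfolding w_def by (auto intro!: derivative_eq_intros der y simp: algebra_simps)
    have "z' y + k * z y = (c * z' y + \<beta> * z y) / c"
      using c by (simp add: k_def field_simps)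
    then show "(z' y + k * z y) * exp (k * y) \<ge> 0" using ineq[OF y] c by simp
  qed
  have "((\<lambda>s. - B * exp (k * s)) \<longlongrightarrow> 0) at_bot"
  proof -
    have "filterlim (\<lambda>s. k * s) at_bot at_bot"
      by (rule filterlim_tendsto_pos_mult_at_bot[OF tendsto_const k filterlim_ident])
    then have "((\<lambda>s. exp (k * s)) \<longlongrightarrow> 0) at_bot"
      by (rule filterlim_compose[OF exp_at_bot])
    from tendsto_mult_right_zero[OF this, of "-B"] show ?thesis by simp
  qed
  moreover have "eventually (\<lambda>s. - B * exp (k * s) \<le> w x) at_bot"
    using eventually_le_at_bot[of x]
  proof eventually_elim
    case (elim s)
    have "- B * exp (k * s) \<le> w s"
      unfolding w_def using bdd[of s] elim x by (intro mult_right_mono) auto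
    also have "\<dots> \<le> w x" using w_mono elim x by blast
    finally show ?case .
  qed
  ultimately have "0 \<le> w x"
    using tendsto_upperbound by (metis trivial_limit_at_bot_linorder)
  then show ?thesis by (simp add: w_def zero_le_mult_iff)
qed

text \<open>The bounded solution is the integral of exp (k (s - x)) g(s) / c over s \<le> x. The
  improper integral is avoided: an antiderivative \<open>E\<close> of
  \<open>exp (k * x) * g x\<close> is shifted by its infimum \<open>m\<close>, which is its limit at
  minus infinity, and comparison of \<open>E\<close> with \<open>B / k * exp (k * x)\<close> gives
  the upper bound.\<close>

lemma bounded_linear_ode_solution:
  fixes g :: "real \<Rightarrow> real"
  assumes c: "c > 0" and \<beta>: "\<beta> > 0" and cont: "continuous_on UNIV g"
    and g: "\<And>x. 0 \<le> g x" "\<And>x. g x \<le> B"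
  obtains y where "\<And>x. (y has_real_derivative (g x - \<beta> * y x) / c) (at x)"
    "\<And>x. 0 \<le> y x" "\<And>x. \<beta> * y x \<le> B"
proof -
  define k where "k = \<beta> / c"
  have k: "k > 0" using c \<beta> by (simp add: k_def)
  \<comment> \<open>Infinite end points yield a single antiderivative on the whole line.\<close>
  have "\<exists>F. \<forall>x::real. -\<infinity> < ereal x \<longrightarrow> ereal x < \<infinity> \<longrightarrow>
      (F has_vector_derivative exp (k * x) * g x) (at x)"
  proof (rule einterval_antiderivative)
    fix x :: real
    show "isCont (\<lambda>x. exp (k * x) * g x) x"
      using cont by (intro continuous_intros) (simp add: continuous_on_eq_continuous_at)
  qed simp
  then obtain E where E: "\<And>x. (E has_real_derivative exp (k * x) * g x) (at x)"
    by (auto simp: has_real_derivative_iff_has_vector_derivative)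
  have E_mono: "E s \<le> E x" if "s \<le> x" for s x
    using g by (intro nondecreasing_of_deriv_nonneg[OF E _ that order_refl]) auto
  have E_up: "E x - E s \<le> B / k * exp (k * x)" if "s \<le> x" for s x
  proof -
    have "B / k * exp (k * s) - E s \<le> B / k * exp (k * x) - E x"
    proof (rule nondecreasing_of_deriv_nonneg[OF _ _ that order_refl])
      fix y
      show "((\<lambda>x. B / k * exp (k * x) - E x) has_real_derivative (B - g y) * exp (k * y)) (at y)"
        using k by (auto intro!: derivative_eq_intros E simp: algebra_simps)
      show "(B - g y) * exp (k * y) \<ge> 0" using g(2)[of y] by simp
    qed
    moreover have "B \<ge> 0" using g(1)[of 0] g(2)[of 0] by linarith
    ultimately show ?thesis using k by (smt (verit) divide_nonneg_pos exp_ge_zero mult_nonneg_nonneg)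
  qed
  define m where "m = Inf (range E)"
  have low: "E x - B / k * exp (k * x) \<le> E s" for x s
  proof (cases "s \<le> x")
    case True then show ?thesis using E_up[OF True] by simp
  next
    case False
    then have "E x \<le> E s" using E_mono by simp
    moreover have "B \<ge> 0" using g(1)[of 0] g(2)[of 0] by linarith
    ultimately show ?thesis using k by (smt (verit) divide_nonneg_pos exp_ge_zero mult_nonneg_nonneg)
  qed
  have bddb: "bdd_below (range E)" using low[of 0] by (intro bdd_belowI2)
  have m1: "m \<le> E x" for x unfolding m_def by (intro cINF_lower bddb) simp
  have m2: "E x - B / k * exp (k * x) \<le> m" for x
    unfolding m_def by (intro cINF_greatest low) simp
  define y where "y = (\<lambda>x. exp (- (k * x)) * (E x - m) / c)"
  show thesis
  proof (rule that[of y])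
    fix x
    have "(y has_real_derivative ((exp (- (k * x)) * (exp (k * x) * g x) + - k * exp (- (k * x)) * (E x - m)) / c)) (at x)"
      unfolding y_def by (rule DERIV_cdivide) (auto intro!: derivative_eq_intros E simp: algebra_simps)
    moreover have "exp (- (k * x)) * (exp (k * x) * g x) = g x"
      by (simp add: mult.assoc[symmetric] exp_add[symmetric])
    moreover have "- k * exp (- (k * x)) * (E x - m) = - \<beta> * y x"
      using c by (simp add: y_def k_def)
    ultimately show "(y has_real_derivative (g x - \<beta> * y x) / c) (at x)" by simp
    show "0 \<le> y x" unfolding y_def using m1 c by simp
    have "exp (- (k * x)) * (E x - m) \<le> exp (- (k * x)) * (B / k * exp (k * x))"
      using m2[of x] by (intro mult_left_mono) auto
    also have "\<dots> = B / k" by (simp add: exp_add[symmetric])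
    finally show "\<beta> * y x \<le> B" using c \<beta> unfolding y_def k_def by (simp add: field_simps)
  qed
qed

lemma lipschitz_of_deriv_bounded:
  fixes y :: "real \<Rightarrow> real"
  assumes "\<And>x. (y has_real_derivative y' x) (at x)" "\<And>x. \<bar>y' x\<bar> \<le> L"
  shows "\<bar>y s - y t\<bar> \<le> L * \<bar>s - t\<bar>"
  using field_differentiable_bound[of UNIV y y' L s t] assms by (auto simp: has_field_derivative_at_within)

section \<open>Convolution with a kernel of mass one\<close>

locale mass_kernel =
  fixes h :: "real \<Rightarrow> real"
  assumes h_nonneg: "\<And>x. h x \<ge> 0" and h_int: "h integrable_on UNIV" and h_one: "integral UNIV h = 1"
begin

lemma conv_integrable:
  assumes "continuous_on UNIV g" "\<And>x. \<bar>g x\<bar> \<le> B"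
  shows "(\<lambda>y. h y * g (x - y)) integrable_on UNIV"
proof -
  have "continuous_on UNIV (\<lambda>y. g (x - y))"
    using assms(1) by (intro continuous_on_compose2[OF assms(1)] continuous_intros) auto
  then have "(\<lambda>y. g (x - y)) \<in> borel_measurable (lebesgue_on UNIV)"
    by (rule continuous_imp_measurable_on_sets_lebesgue) simp
  moreover have "bounded (range (\<lambda>y. g (x - y)))"
    using assms(2) by (auto simp: bounded_iff)
  ultimately have "(\<lambda>y. g (x - y) * h y) absolutely_integrable_on UNIV"
    by (intro absolutely_integrable_bounded_measurable_product_real
        nonnegative_absolutely_integrable_1 h_int h_nonneg) auto
  then show ?thesis
    by (simp add: mult.commute set_lebesgue_integral_eq_integral(1))
qed

lemma conv_const: "conv h (\<lambda>x. k) \<xi> = k"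
  by (simp add: conv_def h_one)

text \<open>Two base points \<open>x\<close> and \<open>x'\<close> are allowed, so the same lemma
  compares two profiles, a profile with its translate, and a profile with its translate plus a
  constant.\<close>

lemma conv_le:
  assumes "continuous_on UNIV g" "\<And>x. \<bar>g x\<bar> \<le> B"
    and "continuous_on UNIV g'" "\<And>x. \<bar>g' x\<bar> \<le> B'"
    and "\<And>y. g (x - y) \<le> g' (x' - y)"
  shows "conv h g x \<le> conv h g' x'"
  unfolding conv_def using assms
  by (intro integral_le conv_integrable[of g B] conv_integrable[of g' B'] mult_left_mono h_nonneg) auto

lemma conv_bounds:
  assumes "continuous_on UNIV g" "\<And>x. g x \<in> {0..K}"
  shows "conv h g x \<in> {0..K}"
proof -
  have "\<bar>g y\<bar> \<le> K" for y using assms(2)[of y] by auto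
  then show ?thesis
    using conv_le[of g K "\<lambda>_. K" "\<bar>K\<bar>" x x] conv_le[of "\<lambda>_. 0" 0 g K x x] assms
    by (auto simp: conv_const)
qed

lemma conv_lipschitz:
  assumes "continuous_on UNIV g" "\<And>x. \<bar>g x\<bar> \<le> B"
    and L: "\<And>x y. \<bar>g x - g y\<bar> \<le> L * \<bar>x - y\<bar>"
  shows "\<bar>conv h g x - conv h g x'\<bar> \<le> L * \<bar>x - x'\<bar>"
proof -
  have "conv h g s \<le> conv h g t + L * \<bar>s - t\<bar>" for s t
  proof -
    have "conv h g s \<le> conv h (\<lambda>z. g z + L * \<bar>s - t\<bar>) t"
    proof (rule conv_le[OF assms(1,2)])
      show "continuous_on UNIV (\<lambda>z. g z + L * \<bar>s - t\<bar>)"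
        using assms(1) by (intro continuous_intros)
      show "\<bar>g x + L * \<bar>s - t\<bar>\<bar> \<le> B + \<bar>L * \<bar>s - t\<bar>\<bar>" for x
        using assms(2)[of x] by linarith
      show "g (s - y) \<le> g (t - y) + L * \<bar>s - t\<bar>" for y
        using L[of "s - y" "t - y"] by simp
    qed
    also have "\<dots> = conv h g t + conv h (\<lambda>_. L * \<bar>s - t\<bar>) t"
      unfolding conv_def distrib_left
      by (intro integral_add conv_integrable[OF assms(1,2)] integrable_on_mult_left h_int)
    finally show ?thesis by (simp add: conv_const)
  qed
  from this[of x x'] this[of x' x] show ?thesis by (simp add: abs_minus_commute abs_le_iff)
qed

text \<open>The base point moves with n: it is constant when profiles converge, and runs to infinity
  with the profile fixed when the limit at plus infinity is computed.\<close>

lemma conv_tendsto: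
  assumes "\<And>n. continuous_on UNIV (g n)" "\<And>n x. \<bar>g n x\<bar> \<le> B"
    and "\<And>y. (\<lambda>n. g n (x n - y)) \<longlonglongrightarrow> g' (x' - y)"
  shows "(\<lambda>n. conv h (g n) (x n)) \<longlonglongrightarrow> conv h g' x'"
  unfolding conv_def
proof (rule dominated_convergence(2))
  show "(\<lambda>y. h y * g n (x n - y)) integrable_on UNIV" for n
    using assms by (intro conv_integrable)
  show "(\<lambda>y. h y * B) integrable_on UNIV"
    by (intro integrable_on_mult_left h_int)
  show "norm (h y * g n (x n - y)) \<le> h y * B" for n y
    using assms(2) h_nonneg by (simp add: abs_mult mult_left_mono)
  show "(\<lambda>n. h y * g n (x n - y)) \<longlonglongrightarrow> h y * g' (x' - y)" for y
    by (intro tendsto_mult_left assms)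
qed

text \<open>The factor b makes the statement meaningful also for b = 0, when the exponential moment of h
  may be infinite.\<close>
lemma conv_exp_upper:
  assumes "b \<ge> 0" and int: "(\<lambda>y. b * (h y * exp (- l * y))) integrable_on UNIV"
    and "continuous_on UNIV g" "\<And>x. \<bar>g x\<bar> \<le> B" "\<And>x. g x \<le> exp (l * x)"
  shows "b * conv h g x \<le> b * kernelG h l * exp (l * x)"
proof -
  have "integral UNIV (\<lambda>y. b * (h y * g (x - y))) \<le>
      integral UNIV (\<lambda>y. b * (h y * exp (- l * y)) * exp (l * x))"
  proof (rule integral_le)
    show "(\<lambda>y. b * (h y * g (x - y))) integrable_on UNIV"
      using conv_integrable[OF assms(3,4)] by (rule integrable_on_mult_right)
    show "(\<lambda>y. b * (h y * exp (- l * y)) * exp (l * x)) integrable_on UNIV"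
      using int by (rule integrable_on_mult_left)
    fix y
    have "h y * g (x - y) \<le> h y * exp (l * (x - y))"
      using assms(5)[of "x - y"] h_nonneg by (simp add: mult_left_mono)
    also have "\<dots> = h y * exp (- l * y) * exp (l * x)"
      by (simp add: algebra_simps exp_add[symmetric])
    finally have "b * (h y * g (x - y)) \<le> b * (h y * exp (- l * y) * exp (l * x))"
      using \<open>b \<ge> 0\<close> by (rule mult_left_mono)
    then show "b * (h y * g (x - y)) \<le> b * (h y * exp (- l * y)) * exp (l * x)"
      by (simp add: mult.assoc)
  qed
  then show ?thesis by (simp add: conv_def kernelG_def)
qed

lemma conv_exp_lower:
  assumes "b \<ge> 0" and int: "(\<lambda>y. b * (h y * exp (- l * y))) integrable_on UNIV"
    "(\<lambda>y. b * (h y * exp (- \<mu> * y))) integrable_on UNIV"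
    and "continuous_on UNIV g" "\<And>x. \<bar>g x\<bar> \<le> B" "\<And>x. exp (l * x) - q * exp (\<mu> * x) \<le> g x"
  shows "b * kernelG h l * exp (l * x) - q * (b * kernelG h \<mu> * exp (\<mu> * x)) \<le> b * conv h g x"
proof -
  let ?u = "\<lambda>l y. b * (h y * exp (- l * y)) * exp (l * x)"
  have I: "?u l integrable_on UNIV" "(\<lambda>y. q * ?u \<mu> y) integrable_on UNIV"
    using int by (auto intro!: integrable_on_mult_left integrable_on_mult_right)
  have "integral UNIV (\<lambda>y. ?u l y - q * ?u \<mu> y) \<le> integral UNIV (\<lambda>y. b * (h y * g (x - y)))"
  proof (rule integral_le)
    show "(\<lambda>y. b * (h y * g (x - y))) integrable_on UNIV"
      using conv_integrable[OF assms(4,5)] by (rule integrable_on_mult_right)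
    show "(\<lambda>y. ?u l y - q * ?u \<mu> y) integrable_on UNIV"
      using I by (rule integrable_diff)
    fix y
    have "?u l y - q * ?u \<mu> y = b * (h y * (exp (l * (x - y)) - q * exp (\<mu> * (x - y))))"
      by (simp add: algebra_simps exp_add[symmetric])
    also have "\<dots> \<le> b * (h y * g (x - y))"
      using assms(6)[of "x - y"] h_nonneg \<open>b \<ge> 0\<close> by (simp add: mult_left_mono)
    finally show "?u l y - q * ?u \<mu> y \<le> b * (h y * g (x - y))" .
  qed
  also have "integral UNIV (\<lambda>y. ?u l y - q * ?u \<mu> y)
      = integral UNIV (?u l) - integral UNIV (\<lambda>y. q * ?u \<mu> y)"
    using I by (rule integral_diff)
  finally show ?thesis by (simp add: conv_def kernelG_def)
qed

end

section \<open>Monotone iteration between the sub- and the supersolution\<close>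

lemma continuous_of_lipschitz:
  fixes g :: "real \<Rightarrow> real"
  assumes "\<And>x y. \<bar>g x - g y\<bar> \<le> L * \<bar>x - y\<bar>"
  shows "continuous_on S g"
proof -
  have "\<bar>g x - g y\<bar> \<le> max L 0 * \<bar>x - y\<bar>" for x y
    using assms[of x y] mult_right_mono[of L "max L 0" "\<bar>x - y\<bar>"] by simp
  then have "(max L 0)-lipschitz_on S g" by (intro lipschitz_onI) (auto simp: dist_real_def)
  then show ?thesis by (rule lipschitz_on_continuous_on)
qed

text \<open>\<open>a\<close> and \<open>b\<close> stand for the partial derivatives at the origin,
  \<open>l\<close> for the smallest zero of Delta, \<open>p\<close> for 1 + sigma. \<open>q\<close>
  is given through the zero \<open>x1\<close> of \<open>chi\<close>, so that q large means
  \<open>x1\<close> far to the left; \<open>x1 \<le> 0\<close> and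
  \<open>exp (l * x1) \<le> K\<close> keep the positive part of \<open>chi\<close> below K and
  inside the half line where a larger exponent means a smaller exponential.
  \<open>Delta_\<mu>\<close> says that q Delta(\<mu>) outweighs the superlinear error.\<close>

locale wave = mass_kernel h for h :: "real \<Rightarrow> real" +
  fixes d tau K a b c l \<mu> q x1 M p :: real
  assumes d_pos: "d > 0" and K_pos: "K > 0" and b_nonneg: "b \<ge> 0" and c_pos: "c > 0"
    and l_pos: "0 < l" and l_less: "l < \<mu>" and \<mu>_le: "\<mu> \<le> p * l" and M_nonneg: "M \<ge> 0"
    and mom_l: "(\<lambda>y. b * (h y * exp (- l * y))) integrable_on UNIV"
    and mom_\<mu>: "(\<lambda>y. b * (h y * exp (- \<mu> * y))) integrable_on UNIV"
    and Delta_l: "charDelta d tau a b h c l = 0"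
    and Delta_\<mu>: "M * (1 + b * exp (- l * c * tau) * kernelG h l) powr p
      \<le> q * charDelta d tau a b h c \<mu>"
    and q_eq: "q = exp ((l - \<mu>) * x1)" and x1_nonpos: "x1 \<le> 0" and x1_K: "exp (l * x1) \<le> K"
begin

section \<open>The barriers, the delayed convolution and the class of profiles\<close>

definition chi :: "real \<Rightarrow> real" where "chi x = exp (l * x) - q * exp (\<mu> * x)"

definition V :: "(real \<Rightarrow> real) \<Rightarrow> real \<Rightarrow> real" where "V \<psi> x = conv h \<psi> (x - c * tau)"

text \<open>The factor by which b times the delayed convolution multiplies exp (m x).\<close>

definition gam :: "real \<Rightarrow> real" where "gam m = b * exp (- m * c * tau) * kernelG h m"

text \<open>All conditions pass to pointwise infima and limits. The Lipschitz bound is included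
  because it yields continuity, which such infima and limits could otherwise lose;
  \<open>0 \<le> \<psi> x\<close> is separate since \<open>chi\<close> is negative right of
  \<open>x1\<close>.\<close>

definition profiles :: "real \<Rightarrow> (real \<Rightarrow> real) set" where
  "profiles L = {\<psi>. mono \<psi> \<and> (\<forall>x. 0 \<le> \<psi> x \<and> \<psi> x \<le> K \<and> chi x \<le> \<psi> x \<and> \<psi> x \<le> exp (l * x)) \<and>
     (\<forall>x y. \<bar>\<psi> x - \<psi> y\<bar> \<le> L * \<bar>x - y\<bar>)}"

lemma profilesD:
  assumes "\<psi> \<in> profiles L"
  shows "mono \<psi>" "0 \<le> \<psi> x" "\<psi> x \<le> K" "chi x \<le> \<psi> x" "\<psi> x \<le> exp (l * x)" "\<bar>\<psi> x\<bar> \<le> K"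
    "\<bar>\<psi> x - \<psi> y\<bar> \<le> L * \<bar>x - y\<bar>" "continuous_on UNIV \<psi>" "\<psi> x \<in> {0..K}"
  using assms continuous_of_lipschitz[of \<psi> L UNIV] by (auto simp: profiles_def)

lemma q_pos: "q > 0" by (simp add: q_eq)

lemma chi_factor: "chi x = exp (l * x) * (1 - exp ((l - \<mu>) * (x1 - x)))"
proof -
  have "q * exp (\<mu> * x) = exp (l * x) * exp ((l - \<mu>) * (x1 - x))"
    unfolding q_eq exp_add[symmetric] by (simp add: algebra_simps)
  then show ?thesis by (simp add: chi_def algebra_simps)
qed

lemma chi_nonneg: "x \<le> x1 \<Longrightarrow> 0 \<le> chi x"
  using l_less by (simp add: chi_factor mult_nonpos_nonneg)

lemma chi_nonpos: "x1 \<le> x \<Longrightarrow> chi x \<le> 0"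
  using l_less by (simp add: chi_factor mult_nonneg_nonpos mult_nonpos_nonpos)

lemma chi_le_exp: "chi x \<le> exp (l * x)"
  using q_pos by (simp add: chi_def)

lemma chi_le_K: "chi x \<le> K"
proof (cases "x \<le> x1")
  case True
  have "chi x \<le> exp (l * x1)"
    using chi_le_exp[of x] True l_pos by (smt (verit) exp_le_cancel_iff mult_left_mono)
  then show ?thesis using x1_K by simp
next
  case False then show ?thesis using chi_nonpos[of x] K_pos by simp
qed

lemma V_bounds: "\<psi> \<in> profiles L \<Longrightarrow> V \<psi> x \<in> {0..K}"
  unfolding V_def by (rule conv_bounds) (simp_all add: profilesD(2,3,8))

lemma V_le:
  assumes "\<psi> \<in> profiles L" "\<psi>' \<in> profiles L'" "\<And>y. \<psi> (x - y) \<le> \<psi>' (x' - y)"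
  shows "V \<psi> x \<le> V \<psi>' x'"
  unfolding V_def
  using assms(3)[of "_ + c * tau"]
  by (intro conv_le[of \<psi> K \<psi>' K] profilesD[OF assms(1)] profilesD[OF assms(2)])
     (simp add: algebra_simps)

lemma V_mono: "\<psi> \<in> profiles L \<Longrightarrow> x \<le> x' \<Longrightarrow> V \<psi> x \<le> V \<psi> x'"
  by (rule V_le[of \<psi> L \<psi> L]) (simp_all add: monoD[OF profilesD(1)])

lemma V_lipschitz: "\<psi> \<in> profiles L \<Longrightarrow> \<bar>V \<psi> x - V \<psi> y\<bar> \<le> L * \<bar>x - y\<bar>"
  unfolding V_def using conv_lipschitz[of \<psi> K L "x - c * tau" "y - c * tau"]
  by (simp add: profilesD)

lemma V_continuous: "\<psi> \<in> profiles L \<Longrightarrow> continuous_on S (V \<psi>)"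
  by (rule continuous_of_lipschitz[OF V_lipschitz])

lemma V_tendsto:
  assumes "\<And>n. \<psi> n \<in> profiles (L n)" "\<And>y. (\<lambda>n. \<psi> n (x n - y)) \<longlonglongrightarrow> \<psi>' (x' - y)"
  shows "(\<lambda>n. V (\<psi> n) (x n)) \<longlonglongrightarrow> V \<psi>' x'"
  unfolding V_def
  using assms(2)[of "_ + c * tau"]
  by (intro conv_tendsto[of \<psi> K] profilesD[OF assms(1)]) (simp add: algebra_simps)

lemma exp_shift: "exp (m * (x - c * tau)) = exp (- m * c * tau) * exp (m * x)"
  by (simp add: exp_add[symmetric] algebra_simps)

lemma V_upper:
  assumes "\<psi> \<in> profiles L"
  shows "b * V \<psi> x \<le> gam l * exp (l * x)"
  using conv_exp_upper[OF b_nonneg mom_l profilesD(8,6,5)[OF assms], of "x - c * tau"]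
  unfolding V_def gam_def exp_shift by (simp add: mult_ac)

text \<open>The bound by \<open>chi\<close> holds on the whole line, also where \<open>chi\<close>
  is negative, so the two exponentials can be integrated separately.\<close>

lemma V_lower:
  assumes "\<psi> \<in> profiles L"
  shows "gam l * exp (l * x) - q * gam \<mu> * exp (\<mu> * x) \<le> b * V \<psi> x"
  using conv_exp_lower[OF b_nonneg mom_l mom_\<mu> profilesD(8,6)[OF assms], of q "x - c * tau"]
    profilesD(4)[OF assms]
  unfolding V_def gam_def exp_shift chi_def by (simp add: mult_ac)

text \<open>For x \<le> 0 the condition \<open>\<mu> \<le> p * l\<close> gives exp (p l x) \<le> exp
  (\<mu> x), and the size of q absorbs the constant \<open>M * C powr p\<close>. This serves both
  for the subsolution and for the linearisation of the reaction at minus infinity.\<close>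

lemma power_term_bound:
  assumes \<psi>: "\<psi> \<in> profiles L" and "x \<le> 0" "0 \<le> u" "u \<le> exp (l * x)"
  shows "M * (u + b * V \<psi> x) powr p \<le> q * charDelta d tau a b h c \<mu> * exp (\<mu> * x)"
proof -
  define C where "C = 1 + gam l"
  have p: "p > 0" using l_pos l_less \<mu>_le by (smt (verit) mult_nonpos_nonneg)
  have nn: "0 \<le> u + b * V \<psi> x"
    using V_bounds[OF \<psi>, of x] b_nonneg assms by simp
  have up: "u + b * V \<psi> x \<le> C * exp (l * x)"
    using V_upper[OF \<psi>, of x] assms by (simp add: C_def distrib_right)
  then have C: "C \<ge> 0" using nn by (smt (verit) exp_gt_zero zero_le_mult_iff)
  have "(u + b * V \<psi> x) powr p \<le> (C * exp (l * x)) powr p"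
    using up nn p by (intro powr_mono2) auto
  also have "\<dots> = C powr p * exp (p * l * x)"
    using C by (simp add: powr_mult exp_powr_real mult_ac)
  also have "\<dots> \<le> C powr p * exp (\<mu> * x)"
    using \<mu>_le \<open>x \<le> 0\<close> by (intro mult_left_mono) (auto intro: mult_right_mono_neg)
  finally have "M * (u + b * V \<psi> x) powr p \<le> M * (C powr p * exp (\<mu> * x))"
    using M_nonneg by (rule mult_left_mono)
  also have "\<dots> \<le> q * charDelta d tau a b h c \<mu> * exp (\<mu> * x)"
    using Delta_\<mu> by (simp add: C_def gam_def mult.assoc[symmetric])
  finally show ?thesis .
qed

text \<open>Monotonicity of \<open>F u v + N * u\<close> makes the operator order preserving; the
  signs at (0, 0) and (K, K) keep its values between 0 and K. \<open>0 \<le> N + a\<close> lets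
  \<psi> be replaced by exp (l x) in the linear bound, and \<open>c * l \<le> N + 2 * d\<close>
  places \<open>min K (exp (l * x))\<close> in \<open>profiles (rate N)\<close>.\<close>

definition reaction :: "real \<Rightarrow> (real \<Rightarrow> real \<Rightarrow> real) \<Rightarrow> bool" where
  "reaction N F \<longleftrightarrow> continuous_on ({0..K} \<times> {0..K}) (\<lambda>(u, v). F u v) \<and>
     (\<forall>u\<in>{0..K}. \<forall>u'\<in>{0..K}. \<forall>v\<in>{0..K}. u \<le> u' \<longrightarrow> F u v + N * u \<le> F u' v + N * u') \<and>
     (\<forall>u\<in>{0..K}. \<forall>v\<in>{0..K}. \<forall>v'\<in>{0..K}. v \<le> v' \<longrightarrow> F u v \<le> F u v') \<and>
     0 \<le> F 0 0 \<and> F K K \<le> 0 \<and>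
     (\<forall>u\<in>{0..K}. \<forall>v\<in>{0..K}. a * u + b * v - M * (u + b * v) powr p \<le> F u v \<and>
        F u v \<le> a * u + b * v) \<and>
     0 \<le> N \<and> 0 \<le> N + a \<and> c * l \<le> N + 2 * d"

text \<open>In c y' = H - (N + 2 d) y both terms on the right lie between 0 and (N + 2 d) K, so this
  number bounds |y'|.\<close>

definition rate :: "real \<Rightarrow> real" where "rate N = (N + 2 * d) * K / c"

text \<open>With (N + 2 d) \<psi> added on both sides, the wave equation for F reads c \<psi>' + (N
  + 2 d) \<psi> = H.\<close>

definition H :: "real \<Rightarrow> (real \<Rightarrow> real \<Rightarrow> real) \<Rightarrow> (real \<Rightarrow> real) \<Rightarrow> real \<Rightarrow> real" where
  "H N F \<psi> x = d * (\<psi> (x + 1) + \<psi> (x - 1)) + (F (\<psi> x) (V \<psi> x) + N * \<psi> x)"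

lemma reactionD:
  assumes "reaction N F"
  shows "continuous_on ({0..K} \<times> {0..K}) (\<lambda>(u, v). F u v)"
    "u \<in> {0..K} \<Longrightarrow> u' \<in> {0..K} \<Longrightarrow> v \<in> {0..K} \<Longrightarrow> u \<le> u' \<Longrightarrow> F u v + N * u \<le> F u' v + N * u'"
    "u \<in> {0..K} \<Longrightarrow> v \<in> {0..K} \<Longrightarrow> v' \<in> {0..K} \<Longrightarrow> v \<le> v' \<Longrightarrow> F u v \<le> F u v'"
    "0 \<le> F 0 0" "F K K \<le> 0"
    "u \<in> {0..K} \<Longrightarrow> v \<in> {0..K} \<Longrightarrow> a * u + b * v - M * (u + b * v) powr p \<le> F u v"
    "u \<in> {0..K} \<Longrightarrow> v \<in> {0..K} \<Longrightarrow> F u v \<le> a * u + b * v"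
    "0 \<le> N" "0 \<le> N + a" "c * l \<le> N + 2 * d"
  using assms by (simp_all add: reaction_def)

lemma reaction_le:
  assumes "reaction N F" "u \<in> {0..K}" "u' \<in> {0..K}" "v \<in> {0..K}" "v' \<in> {0..K}" "u \<le> u'" "v \<le> v'"
  shows "F u v + N * u \<le> F u' v' + N * u'"
proof -
  have "F u v + N * u \<le> F u' v + N * u'" "F u' v \<le> F u' v'"
    using assms by (auto intro: reactionD)
  then show ?thesis by simp
qed

text \<open>With \<open>x = x'\<close> this is order preservation; with
  \<open>\<psi> = \<psi>'\<close> it makes \<open>H N F \<psi>\<close> nondecreasing.\<close>

lemma H_le:
  assumes F: "reaction N F" and "\<psi> \<in> profiles L" "\<psi>' \<in> profiles L'"
    and le: "\<And>y. \<psi> (x + y) \<le> \<psi>' (x' + y)"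
  shows "H N F \<psi> x \<le> H N F \<psi>' x'"
proof -
  have "\<psi> (x - y) \<le> \<psi>' (x' - y)" for y using le[of "- y"] by simp
  then have "V \<psi> x \<le> V \<psi>' x'" using assms by (intro V_le)
  then have "F (\<psi> x) (V \<psi> x) + N * \<psi> x \<le> F (\<psi>' x') (V \<psi>' x') + N * \<psi>' x'"
    using le[of 0] assms by (intro reaction_le[OF F] V_bounds profilesD) auto
  moreover have "d * (\<psi> (x + 1) + \<psi> (x - 1)) \<le> d * (\<psi>' (x' + 1) + \<psi>' (x' - 1))"
    using le[of 1] le[of "-1"] d_pos by (intro mult_left_mono add_mono) auto
  ultimately show ?thesis unfolding H_def by (rule add_mono[rotated])
qed

lemma H_nonneg:
  assumes "reaction N F" "\<psi> \<in> profiles L"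
  shows "0 \<le> H N F \<psi> x"
proof -
  have "F 0 0 + N * 0 \<le> F (\<psi> x) (V \<psi> x) + N * \<psi> x"
    using K_pos profilesD(9)[OF assms(2), of x] V_bounds[OF assms(2), of x]
    by (intro reaction_le[OF assms(1)]) auto
  moreover have "0 \<le> d * (\<psi> (x + 1) + \<psi> (x - 1))"
    using profilesD(2)[OF assms(2)] d_pos by simp
  ultimately show ?thesis using reactionD(4)[OF assms(1)] by (simp add: H_def)
qed

lemma H_le_const:
  assumes "reaction N F" "\<psi> \<in> profiles L"
  shows "H N F \<psi> x \<le> (N + 2 * d) * K"
proof -
  have "F (\<psi> x) (V \<psi> x) + N * \<psi> x \<le> F K K + N * K"
    using assms K_pos profilesD(9)[OF assms(2), of x] V_bounds[OF assms(2), of x]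
    by (intro reaction_le[OF assms(1)]) auto
  moreover have "F K K \<le> 0" by (rule reactionD(5)[OF assms(1)])
  moreover have "d * (\<psi> (x + 1) + \<psi> (x - 1)) \<le> d * (K + K)"
    using profilesD(3)[OF assms(2)] d_pos by (intro mult_left_mono add_mono) auto
  ultimately show ?thesis by (simp add: H_def algebra_simps)
qed

lemma reaction_continuous:
  assumes F: "continuous_on ({0..K} \<times> {0..K}) (\<lambda>(u, v). F u v)" and \<psi>: "\<psi> \<in> profiles L"
  shows "continuous_on S (\<lambda>x. F (\<psi> x) (V \<psi> x))"
proof -
  have "continuous_on S (\<lambda>x. (\<psi> x, V \<psi> x))"
    using V_continuous[OF \<psi>] continuous_on_subset[OF profilesD(8)[OF \<psi>]]
    by (intro continuous_intros) auto
  moreover have "(\<lambda>x. (\<psi> x, V \<psi> x)) ` S \<subseteq> {0..K} \<times> {0..K}"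
    using profilesD(9)[OF \<psi>] V_bounds[OF \<psi>] by blast
  ultimately show ?thesis
    using continuous_on_compose2[OF F] by fastforce
qed

lemma H_continuous:
  assumes F: "reaction N F" and \<psi>: "\<psi> \<in> profiles L"
  shows "continuous_on UNIV (H N F \<psi>)"
proof -
  have "continuous_on UNIV (\<lambda>x. F (\<psi> x) (V \<psi> x))"
    by (rule reaction_continuous[OF reactionD(1)[OF F] \<psi>])
  moreover note \<psi>c = profilesD(8)[OF \<psi>]
  moreover have "continuous_on UNIV (\<lambda>x. \<psi> (x + 1))" "continuous_on UNIV (\<lambda>x. \<psi> (x - 1))"
    by (intro continuous_on_compose2[OF \<psi>c] continuous_intros; simp)+
  ultimately show ?thesis
    unfolding H_def by (intro continuous_intros)
qed

text \<open>The right-hand side is c u' + (N + 2 d) u for u = exp (l x). Bounding F by its linear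
  part and every value of \<psi> by u reduces the claim to Delta(l) = 0; nonnegativity of
  \<open>N + a\<close> enters because a itself may be negative.\<close>

lemma H_le_exp:
  assumes F: "reaction N F" and \<psi>: "\<psi> \<in> profiles L"
  shows "H N F \<psi> x \<le> (c * l + (N + 2 * d)) * exp (l * x)"
proof -
  have "F (\<psi> x) (V \<psi> x) \<le> a * \<psi> x + b * V \<psi> x"
    by (intro reactionD(7)[OF F] profilesD(9)[OF \<psi>] V_bounds[OF \<psi>])
  moreover have "(N + a) * \<psi> x \<le> (N + a) * exp (l * x)"
    by (intro mult_left_mono profilesD(5)[OF \<psi>] reactionD(9)[OF F])
  moreover have "d * (\<psi> (x + 1) + \<psi> (x - 1)) \<le> d * ((exp l + exp (- l)) * exp (l * x))"
  proof -
    have "\<psi> (x + 1) + \<psi> (x - 1) \<le> exp (l * (x + 1)) + exp (l * (x - 1))"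
      using profilesD(5)[OF \<psi>] by (intro add_mono)
    also have "\<dots> = (exp l + exp (- l)) * exp (l * x)"
      by (simp add: exp_add[symmetric] algebra_simps)
    finally show ?thesis using d_pos by (intro mult_left_mono) auto
  qed
  moreover have "c * l * exp (l * x) = (d * (exp l + exp (- l) - 2) + a + gam l) * exp (l * x)"
    using Delta_l by (simp add: charDelta_def gam_def)
  moreover note V_upper[OF \<psi>, of x]
  ultimately show ?thesis
    by (simp add: H_def algebra_simps)
qed

text \<open>The left-hand side is c chi' + (N + 2 d) chi. Left of \<open>x1\<close> the value
  \<open>chi x\<close> is an admissible first argument of F. The second argument stays
  \<open>V \<psi> x\<close>, as the convolution of \<open>chi\<close> may leave [0, K]. The exp (l
  x) terms cancel by Delta(l) = 0, and the exp (\<mu> x) terms leave q Delta(\<mu>) exp (\<mu> x),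
  which pays for the power term.\<close>

lemma H_ge_chi:
  assumes F: "reaction N F" and \<psi>: "\<psi> \<in> profiles L" and x: "x \<le> x1"
  shows "c * (l * exp (l * x) - q * (\<mu> * exp (\<mu> * x))) + (N + 2 * d) * chi x \<le> H N F \<psi> x"
proof -
  let ?D = "charDelta d tau a b h c \<mu>"
  have chi: "chi x \<in> {0..K}" using chi_nonneg[OF x] chi_le_K by simp
  have "F (chi x) (V \<psi> x) + N * chi x \<le> F (\<psi> x) (V \<psi> x) + N * \<psi> x"
    using chi profilesD[OF \<psi>] V_bounds[OF \<psi>, of x] by (intro reaction_le[OF F]) auto
  moreover have "a * chi x + b * V \<psi> x - M * (chi x + b * V \<psi> x) powr p \<le> F (chi x) (V \<psi> x)"
    by (intro reactionD(6)[OF F] chi V_bounds[OF \<psi>])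
  moreover have "M * (chi x + b * V \<psi> x) powr p \<le> q * ?D * exp (\<mu> * x)"
    using x x1_nonpos chi chi_le_exp by (intro power_term_bound[OF \<psi>]) auto
  moreover have "d * ((exp l + exp (- l)) * exp (l * x) - q * ((exp \<mu> + exp (- \<mu>)) * exp (\<mu> * x)))
      \<le> d * (\<psi> (x + 1) + \<psi> (x - 1))"
  proof -
    have "(exp l + exp (- l)) * exp (l * x) - q * ((exp \<mu> + exp (- \<mu>)) * exp (\<mu> * x))
        = chi (x + 1) + chi (x - 1)"
      by (simp add: chi_def exp_add[symmetric] algebra_simps)
    also have "\<dots> \<le> \<psi> (x + 1) + \<psi> (x - 1)"
      using profilesD(4)[OF \<psi>] by (intro add_mono)
    finally show ?thesis using d_pos by (intro mult_left_mono) auto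
  qed
  moreover have "c * (l * exp (l * x)) = (d * (exp l + exp (- l) - 2) + a + gam l) * exp (l * x)"
    using Delta_l by (simp add: charDelta_def gam_def)
  moreover have "q * ?D * exp (\<mu> * x)
      = q * (c * \<mu> - d * (exp \<mu> + exp (- \<mu>) - 2) - a - gam \<mu>) * exp (\<mu> * x)"
    by (simp add: charDelta_def gam_def)
  moreover note V_lower[OF \<psi>, of x]
  ultimately show ?thesis
    by (simp add: H_def chi_def algebra_simps)
qed

section \<open>The fixed point problem for one admissible nonlinearity\<close>

definition lap_reaction :: "(real \<Rightarrow> real \<Rightarrow> real) \<Rightarrow> (real \<Rightarrow> real) \<Rightarrow> real \<Rightarrow> real" where
  "lap_reaction F \<psi> x = d * dlap \<psi> x + F (\<psi> x) (V \<psi> x)"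

lemma H_eq: "H N F \<psi> x = lap_reaction F \<psi> x + (N + 2 * d) * \<psi> x"
  by (simp add: H_def lap_reaction_def dlap_def algebra_simps)

lemma reaction_rate_pos: "reaction N F \<Longrightarrow> N + 2 * d > 0"
  using d_pos reactionD(8)[of N F] by simp

lemma linear_comparison_line:
  assumes "\<beta> > 0" "\<And>x. (z has_real_derivative z' x) (at x)" "\<And>x. 0 \<le> c * z' x + \<beta> * z x"
    "\<And>x. - B \<le> z x"
  shows "0 \<le> z x"
  by (rule linear_comparison[OF c_pos assms(1), where z' = z' and B = B and b = x]) (use assms in auto)

lemma c_cancel: "c * (u / c - v) = u - c * v" "c * (u - v / c) = c * u - v" "c * (u / c) = u"
  using c_pos by (simp_all add: field_simps)

text \<open>One application of the operator. Linear comparison is applied to differences: with a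
  translate for monotonicity, with exp (l x) for the upper barrier, and with \<open>chi\<close> on x
  \<le> \<open>x1\<close>, beyond which \<open>chi\<close> is nonpositive. \<open>B = K\<close> is
  the crude lower bound on these differences.\<close>

lemma iteration_step:
  assumes F: "reaction N F" and \<psi>: "\<psi> \<in> profiles L"
  obtains y where "y \<in> profiles (rate N)"
    "\<And>x. (y has_real_derivative (H N F \<psi> x - (N + 2 * d) * y x) / c) (at x)"
proof -
  let ?\<beta> = "N + 2 * d"
  have \<beta>: "?\<beta> > 0" by (rule reaction_rate_pos[OF F])
  obtain y where der: "\<And>x. (y has_real_derivative (H N F \<psi> x - ?\<beta> * y x) / c) (at x)"
    and y0: "\<And>x. 0 \<le> y x" and yK: "\<And>x. ?\<beta> * y x \<le> ?\<beta> * K"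
    using bounded_linear_ode_solution[OF c_pos \<beta> H_continuous[OF F \<psi>] H_nonneg[OF F \<psi>]
      H_le_const[OF F \<psi>]] by blast
  have yK': "y x \<le> K" for x using yK[of x] \<beta> by simp
  have lip: "\<bar>y s - y t\<bar> \<le> rate N * \<bar>s - t\<bar>" for s t
  proof (rule lipschitz_of_deriv_bounded[OF der])
    fix x
    have "\<bar>H N F \<psi> x - ?\<beta> * y x\<bar> \<le> ?\<beta> * K"
      using H_nonneg[OF F \<psi>, of x] H_le_const[OF F \<psi>, of x] yK[of x] y0[of x] \<beta>
        mult_nonneg_nonneg[of ?\<beta> "y x"] by linarith
    then show "\<bar>(H N F \<psi> x - ?\<beta> * y x) / c\<bar> \<le> rate N"
      using c_pos by (simp add: rate_def divide_right_mono)
  qed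
  have mono: "mono y"
  proof (rule monoI)
    fix s t :: real assume "s \<le> t"
    define r where "r = t - s"
    have r: "r \<ge> 0" using \<open>s \<le> t\<close> by (simp add: r_def)
    have "0 \<le> y (s + r) - y s"
    proof (rule linear_comparison_line[OF \<beta>, where z = "\<lambda>x. y (x + r) - y x" and B = K])
      fix x
      have "((\<lambda>x. y (x + r)) has_real_derivative (H N F \<psi> (x + r) - ?\<beta> * y (x + r)) / c) (at x)"
        using der[of "x + r"] by (simp add: DERIV_shift)
      then show "((\<lambda>x. y (x + r) - y x) has_real_derivative
          (H N F \<psi> (x + r) - ?\<beta> * y (x + r)) / c - (H N F \<psi> x - ?\<beta> * y x) / c) (at x)"
        by (intro DERIV_diff der)
      have "H N F \<psi> x \<le> H N F \<psi> (x + r)"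
        using r by (intro H_le[OF F \<psi> \<psi>] monoD[OF profilesD(1)[OF \<psi>]]) simp
      then show "0 \<le> c * ((H N F \<psi> (x + r) - ?\<beta> * y (x + r)) / c - (H N F \<psi> x - ?\<beta> * y x) / c)
          + ?\<beta> * (y (x + r) - y x)"
        unfolding c_cancel by (simp add: algebra_simps)
      show "- K \<le> y (x + r) - y x" using y0[of "x + r"] yK'[of x] by simp
    qed
    then show "y s \<le> y t" by (simp add: r_def)
  qed
  have "y x \<le> exp (l * x)" for x
  proof -
    have "0 \<le> exp (l * x) - y x"
    proof (rule linear_comparison_line[OF \<beta>, where z = "\<lambda>x. exp (l * x) - y x" and B = K])
      fix x
      show "((\<lambda>x. exp (l * x) - y x) has_real_derivative
          l * exp (l * x) - (H N F \<psi> x - ?\<beta> * y x) / c) (at x)"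
        by (intro DERIV_diff der) (auto intro!: derivative_eq_intros)
      show "0 \<le> c * (l * exp (l * x) - (H N F \<psi> x - ?\<beta> * y x) / c) + ?\<beta> * (exp (l * x) - y x)"
        unfolding c_cancel using H_le_exp[OF F \<psi>, of x] by (simp add: algebra_simps)
      show "- K \<le> exp (l * x) - y x" using yK'[of x] by (smt (verit) exp_gt_zero)
    qed
    then show ?thesis by simp
  qed
  moreover have "chi x \<le> y x" for x
  proof (cases "x \<le> x1")
    case True
    have "0 \<le> y x - chi x"
    proof (rule linear_comparison[OF c_pos \<beta> _ _ _ True, where z = "\<lambda>x. y x - chi x" and B = K])
      fix x assume x: "x \<le> x1"
      show "((\<lambda>x. y x - chi x) has_real_derivative (H N F \<psi> x - ?\<beta> * y x) / c
          - (l * exp (l * x) - q * (\<mu> * exp (\<mu> * x)))) (at x)"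
        unfolding chi_def by (intro DERIV_diff der) (auto intro!: derivative_eq_intros)
      show "0 \<le> c * ((H N F \<psi> x - ?\<beta> * y x) / c - (l * exp (l * x) - q * (\<mu> * exp (\<mu> * x))))
          + ?\<beta> * (y x - chi x)"
        unfolding c_cancel using H_ge_chi[OF F \<psi> x] by (simp add: algebra_simps)
      show "- K \<le> y x - chi x" using y0[of x] chi_le_K[of x] by simp
    qed
    then show ?thesis by simp
  next
    case False
    then show ?thesis using chi_nonpos[of x] y0[of x] by simp
  qed
  ultimately have "y \<in> profiles (rate N)"
    using mono lip y0 yK' by (simp add: profiles_def)
  then show thesis using der that by blast
qed

text \<open>The largest candidate, which shows that the set of supersolutions is not empty. The
  slope is at most l K; this follows from 1 - z \<le> exp (- z) without differentiating the
  minimum.\<close>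

lemma upper_profile:
  assumes L: "l * K \<le> L"
  shows "(\<lambda>x. min K (exp (l * x))) \<in> profiles L"
proof -
  let ?g = "\<lambda>x. min K (exp (l * x))"
  have mono: "mono ?g"
    using l_pos by (intro monoI min.mono) simp_all
  have "?g t - ?g s \<le> L * (t - s)" if "s \<le> t" for s t
  proof (cases "exp (l * s) \<le> K")
    case True
    have "?g t * (1 - l * (t - s)) \<le> ?g t * exp (- (l * (t - s)))"
      using exp_ge_add_one_self[of "- (l * (t - s))"] K_pos by (intro mult_left_mono) auto
    also have "\<dots> \<le> exp (l * t) * exp (- (l * (t - s)))"
      by (intro mult_right_mono) auto
    also have "\<dots> = ?g s"
      using True by (simp add: exp_add[symmetric] algebra_simps)
    finally have "?g t * (1 - l * (t - s)) \<le> ?g s" .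
    then have "?g t - ?g s \<le> ?g t * (l * (t - s))"
      unfolding right_diff_distrib by linarith
    also have "\<dots> \<le> K * (l * (t - s))"
      using l_pos that by (intro mult_right_mono) auto
    also have "\<dots> \<le> L * (t - s)"
      using mult_right_mono[OF L, of "t - s"] that by (simp add: mult_ac)
    finally show ?thesis .
  next
    case False
    have "0 \<le> L * (t - s)" using L l_pos K_pos that by (smt (verit) mult_nonneg_nonneg)
    then show ?thesis using False by (simp add: min_def)
  qed
  then have "\<bar>?g s - ?g t\<bar> \<le> L * \<bar>s - t\<bar>" for s t
    using monoD[OF mono, of s t] monoD[OF mono, of t s] linear[of s t]
    by (elim disjE) (simp_all only: abs_of_nonneg abs_of_nonpos diff_ge_0_iff_ge diff_le_0_iff_le minus_diff_eq)
  then show ?thesis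
    using mono K_pos chi_le_K chi_le_exp by (simp add: profiles_def)
qed

lemma cINF_profiles:
  assumes S: "S \<subseteq> profiles L" "S \<noteq> {}" and L: "L \<ge> 0"
  shows "(\<lambda>x. INF \<psi>\<in>S. \<psi> x) \<in> profiles L" and "\<psi> \<in> S \<Longrightarrow> (INF \<psi>\<in>S. \<psi> x) \<le> \<psi> x"
proof -
  note SD = profilesD[OF subsetD[OF S(1)]]
  have bdd: "bdd_below ((\<lambda>\<psi>. \<psi> x) ` S)" for x
    using SD(2) by (intro bdd_belowI2)
  show lower: "(INF \<psi>\<in>S. \<psi> x) \<le> \<psi> x" if "\<psi> \<in> S" for \<psi> x
    using bdd that by (rule cINF_lower)
  obtain \<psi>0 where \<psi>0: "\<psi>0 \<in> S" using S by blast
  have lip: "(INF \<psi>\<in>S. \<psi> s) \<le> (INF \<psi>\<in>S. \<psi> t) + L * \<bar>s - t\<bar>" for s t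
  proof -
    have "(INF \<psi>\<in>S. \<psi> s) - L * \<bar>s - t\<bar> \<le> (INF \<psi>\<in>S. \<psi> t)"
    proof (rule cINF_greatest[OF S(2)])
      fix \<psi> assume "\<psi> \<in> S"
      then show "(INF \<psi>\<in>S. \<psi> s) - L * \<bar>s - t\<bar> \<le> \<psi> t"
        using lower[of \<psi> s] SD(7)[of \<psi> s t] by linarith
    qed
    then show ?thesis by simp
  qed
  have "\<bar>(INF \<psi>\<in>S. \<psi> s) - (INF \<psi>\<in>S. \<psi> t)\<bar> \<le> L * \<bar>s - t\<bar>" for s t
    using lip[of s t] lip[of t s] by (simp add: abs_minus_commute abs_le_iff)
  moreover have "mono (\<lambda>x. INF \<psi>\<in>S. \<psi> x)"
    using SD(1) by (intro monoI cINF_mono S bdd) (auto dest: monoD)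
  moreover have "0 \<le> (INF \<psi>\<in>S. \<psi> x)" "chi x \<le> (INF \<psi>\<in>S. \<psi> x)" for x
    using SD by (auto intro!: cINF_greatest S)
  moreover have "(INF \<psi>\<in>S. \<psi> x) \<le> K" "(INF \<psi>\<in>S. \<psi> x) \<le> exp (l * x)" for x
    using lower[OF \<psi>0, of x] SD(3,5)[OF \<psi>0, of x] by linarith+
  ultimately show "(\<lambda>x. INF \<psi>\<in>S. \<psi> x) \<in> profiles L"
    by (simp add: profiles_def)
qed

text \<open>Knaster-Tarski: the infimum of all supersolutions is a fixed point of the iteration.\<close>
lemma minimal_solution:
  assumes F: "reaction N F"
  obtains \<phi> where "\<phi> \<in> profiles (rate N)"
    "\<And>x. (\<phi> has_real_derivative lap_reaction F \<phi> x / c) (at x)"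
    "\<And>\<psi> \<psi>' x. \<psi> \<in> profiles (rate N) \<Longrightarrow> (\<And>x. (\<psi> has_real_derivative \<psi>' x) (at x)) \<Longrightarrow>
      (\<And>x. lap_reaction F \<psi> x \<le> c * \<psi>' x) \<Longrightarrow> \<phi> x \<le> \<psi> x"
proof -
  let ?\<beta> = "N + 2 * d"
  let ?P = "profiles (rate N)"
  have \<beta>: "?\<beta> > 0" by (rule reaction_rate_pos[OF F])
  have "\<forall>\<psi>\<in>?P. \<exists>y. y \<in> ?P \<and> (\<forall>x. (y has_real_derivative (H N F \<psi> x - ?\<beta> * y x) / c) (at x))"
    by (meson iteration_step[OF F])
  from bchoice[OF this]
  obtain T where T: "\<And>\<psi>. \<psi> \<in> ?P \<Longrightarrow> T \<psi> \<in> ?P"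
    and T': "\<And>\<psi> x. \<psi> \<in> ?P \<Longrightarrow> (T \<psi> has_real_derivative (H N F \<psi> x - ?\<beta> * T \<psi> x) / c) (at x)"
    by blast
  \<comment> \<open>Two instances matter: \<open>\<psi>1 = \<psi>\<close> turns a differentiable
    supersolution into one in the sense of \<open>T\<close>, and \<open>\<psi> = T \<psi>2\<close>
    gives monotonicity of \<open>T\<close>.\<close>
  have T_below: "T \<psi>1 x \<le> \<psi> x"
    if "\<psi>1 \<in> ?P" "\<psi> \<in> ?P" "\<And>x. (\<psi> has_real_derivative \<psi>' x) (at x)"
      "\<And>x. H N F \<psi>1 x \<le> c * \<psi>' x + ?\<beta> * \<psi> x" for \<psi>1 \<psi> \<psi>' x
  proof -
    have "0 \<le> \<psi> x - T \<psi>1 x"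
    proof (rule linear_comparison_line[OF \<beta>, where z = "\<lambda>x. \<psi> x - T \<psi>1 x" and B = K])
      fix x
      show "((\<lambda>x. \<psi> x - T \<psi>1 x) has_real_derivative
          \<psi>' x - (H N F \<psi>1 x - ?\<beta> * T \<psi>1 x) / c) (at x)"
        by (intro DERIV_diff that T')
      show "0 \<le> c * (\<psi>' x - (H N F \<psi>1 x - ?\<beta> * T \<psi>1 x) / c) + ?\<beta> * (\<psi> x - T \<psi>1 x)"
        unfolding c_cancel using that(4)[of x] by (simp add: algebra_simps)
      show "- K \<le> \<psi> x - T \<psi>1 x"
        using profilesD(2)[OF that(2), of x] profilesD(3)[OF T[OF that(1)], of x] by simp
    qed
    then show ?thesis by simp
  qed
  have T_mono: "T \<psi>1 x \<le> T \<psi>2 x" if "\<psi>1 \<in> ?P" "\<psi>2 \<in> ?P" "\<And>x. \<psi>1 x \<le> \<psi>2 x" for \<psi>1 \<psi>2 x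
  proof (rule T_below[OF that(1) T[OF that(2)] T'[OF that(2)]])
    show "H N F \<psi>1 x \<le> c * ((H N F \<psi>2 x - ?\<beta> * T \<psi>2 x) / c) + ?\<beta> * T \<psi>2 x" for x
      using H_le[OF F that(1,2), of x x] that(3) c_pos by simp
  qed
  \<comment> \<open>Supersolutions are expressed through \<open>T\<close>, since neither
    \<open>min K (exp (l * x))\<close> nor an infimum need be differentiable.\<close>
  define S where "S = {\<psi> \<in> ?P. \<forall>x. T \<psi> x \<le> \<psi> x}"
  define \<phi> where "\<phi> = (\<lambda>x. INF \<psi>\<in>S. \<psi> x)"
  have rate: "l * K \<le> rate N"
    using mult_right_mono[OF reactionD(10)[OF F], of K] K_pos c_pos
    by (simp add: rate_def field_simps)
  let ?g = "\<lambda>x. min K (exp (l * x))"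
  have g: "?g \<in> ?P" by (rule upper_profile[OF rate])
  have "?g \<in> S"
    using g profilesD(3,5)[OF T[OF g]] by (auto simp: S_def)
  then have S: "S \<subseteq> ?P" "S \<noteq> {}" unfolding S_def by auto
  have "0 \<le> l * K" using l_pos K_pos by simp
  then have "0 \<le> rate N" using rate by linarith
  note inf = cINF_profiles[OF S this, folded \<phi>_def]
  have \<phi>: "\<phi> \<in> ?P" using inf(1) by (simp add: \<phi>_def)
  have lower: "\<phi> x \<le> \<psi> x" if "\<psi> \<in> S" for \<psi> x
    using inf(2)[OF that] by (simp add: \<phi>_def)
  have T\<phi>: "T \<phi> x \<le> \<phi> x" for x
  proof -
    have "T \<phi> x \<le> (INF \<psi>\<in>S. \<psi> x)"
    proof (rule cINF_greatest[OF S(2)])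
      fix \<psi> assume \<psi>: "\<psi> \<in> S"
      then have "T \<phi> x \<le> T \<psi> x" using S lower by (intro T_mono[OF \<phi>]) auto
      then show "T \<phi> x \<le> \<psi> x" using \<psi> by (auto simp: S_def intro: order_trans)
    qed
    then show ?thesis by (simp add: \<phi>_def)
  qed
  have "T \<phi> \<in> S" using T_mono[OF T[OF \<phi>] \<phi> T\<phi>] T[OF \<phi>] by (simp add: S_def)
  then have "T \<phi> = \<phi>" using lower T\<phi> by (intro ext antisym)
  with T'[OF \<phi>] have der: "(\<phi> has_real_derivative lap_reaction F \<phi> x / c) (at x)" for x
    by (simp add: H_eq)
  show thesis
  proof (rule that[OF \<phi> der])
    fix \<psi> \<psi>' x
    assume *: "\<psi> \<in> ?P" "\<And>x. (\<psi> has_real_derivative \<psi>' x) (at x)"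
      "\<And>x. lap_reaction F \<psi> x \<le> c * \<psi>' x"
    have "T \<psi> x \<le> \<psi> x" for x
      using *(3) by (intro T_below[OF *(1,1,2)]) (simp add: H_eq)
    then show "\<phi> x \<le> \<psi> x" using * by (intro lower) (simp add: S_def)
  qed
qed

section \<open>Removing the regularisation\<close>

lemma profiles_limit:
  assumes "\<And>n. \<phi> n \<in> profiles L" "\<And>x. (\<lambda>n. \<phi> n x) \<longlonglongrightarrow> \<psi> x"
  shows "\<psi> \<in> profiles L"
proof -
  have "mono \<psi>"
    by (intro monoI LIMSEQ_le[OF assms(2) assms(2)]) (auto intro: monoD[OF profilesD(1)[OF assms(1)]])
  moreover have "0 \<le> \<psi> x" "chi x \<le> \<psi> x" for x
    by (intro LIMSEQ_le_const[OF assms(2)]; use profilesD(2,4)[OF assms(1)] in auto)+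
  moreover have "\<psi> x \<le> K" "\<psi> x \<le> exp (l * x)" for x
    by (intro LIMSEQ_le_const2[OF assms(2)]; use profilesD(3,5)[OF assms(1)] in auto)+
  moreover have "\<bar>\<psi> x - \<psi> y\<bar> \<le> L * \<bar>x - y\<bar>" for x y
    by (intro LIMSEQ_le_const2[OF tendsto_rabs[OF tendsto_diff[OF assms(2) assms(2)]]])
       (use profilesD(7)[OF assms(1)] in auto)
  ultimately show ?thesis by (simp add: profiles_def)
qed

lemma profiles_weaken:
  assumes "\<psi> \<in> profiles L" "L \<le> L'"
  shows "\<psi> \<in> profiles L'"
proof -
  have "\<bar>\<psi> x - \<psi> y\<bar> \<le> L' * \<bar>x - y\<bar>" for x y
    using profilesD(7)[OF assms(1), of x y] mult_right_mono[OF assms(2), of "\<bar>x - y\<bar>"] by linarith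
  then show ?thesis using assms(1) by (simp add: profiles_def)
qed

lemma dlap_bound:
  assumes "\<psi> \<in> profiles L"
  shows "\<bar>dlap \<psi> x\<bar> \<le> 2 * K"
  unfolding dlap_def abs_le_iff
  using profilesD(2,3)[OF assms, of x] profilesD(2,3)[OF assms, of "x + 1"]
    profilesD(2,3)[OF assms, of "x - 1"] by linarith

lemma lap_reaction_bound:
  assumes "\<psi> \<in> profiles L" "\<And>u v. u \<in> {0..K} \<Longrightarrow> v \<in> {0..K} \<Longrightarrow> \<bar>F u v\<bar> \<le> S"
  shows "\<bar>lap_reaction F \<psi> x\<bar> \<le> 2 * d * K + S"
proof -
  have "\<bar>d * dlap \<psi> x\<bar> \<le> d * (2 * K)"
    unfolding abs_mult using dlap_bound[OF assms(1)] d_pos by (intro mult_mono) auto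
  moreover have "\<bar>F (\<psi> x) (V \<psi> x)\<bar> \<le> S"
    by (intro assms(2) profilesD(9)[OF assms(1)] V_bounds[OF assms(1)])
  ultimately show ?thesis by (simp add: lap_reaction_def)
qed

lemma lap_reaction_continuous:
  assumes F: "continuous_on ({0..K} \<times> {0..K}) (\<lambda>(u, v). F u v)" and \<psi>: "\<psi> \<in> profiles L"
  shows "continuous_on S (lap_reaction F \<psi>)"
proof -
  note \<psi>c = profilesD(8)[OF \<psi>]
  have "continuous_on S (\<lambda>x. \<psi> (x + 1))" "continuous_on S (\<lambda>x. \<psi> (x - 1))" "continuous_on S \<psi>"
    by (intro continuous_on_compose2[OF \<psi>c] continuous_intros continuous_on_subset[OF \<psi>c]; simp)+
  then show ?thesis
    using reaction_continuous[OF assms, of S] unfolding lap_reaction_def dlap_def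
    by (intro continuous_intros)
qed

text \<open>\<open>L\<close> comes from the equation and the common bound \<open>S\<close>, hence
  does not depend on n, while \<open>S \<le> N n * K\<close> gives
  \<open>L \<le> rate (N n)\<close>. So \<open>\<phi> (Suc n)\<close> lies in the class where
  \<open>\<phi> n\<close> is minimal, and it is a supersolution there because F increases with n;
  hence the profiles increase.\<close>

lemma solution_of_approximations:
  fixes F :: "nat \<Rightarrow> real \<Rightarrow> real \<Rightarrow> real"
  assumes F: "\<And>n. reaction (N n) (F n)" and S: "\<And>n. S \<le> N n * K"
    and F_bound: "\<And>n u v. u \<in> {0..K} \<Longrightarrow> v \<in> {0..K} \<Longrightarrow> \<bar>F n u v\<bar> \<le> S"
    and F_mono: "\<And>n u v. u \<in> {0..K} \<Longrightarrow> v \<in> {0..K} \<Longrightarrow> F n u v \<le> F (Suc n) u v"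
    and f: "continuous_on ({0..K} \<times> {0..K}) (\<lambda>(u, v). f u v)"
    and lim: "uniform_limit ({0..K} \<times> {0..K}) (\<lambda>n (u, v). F n u v) (\<lambda>(u, v). f u v) sequentially"
  obtains \<phi> L where "\<phi> \<in> profiles L"
    "\<And>x. (\<phi> has_real_derivative lap_reaction f \<phi> x / c) (at x)"
proof -
  define L where "L = (2 * d * K + S) / c"
  have L_rate: "L \<le> rate (N n)" for n
    using S[of n] c_pos unfolding L_def rate_def by (intro divide_right_mono) (auto simp: algebra_simps)
  have "\<exists>\<phi>. \<phi> \<in> profiles (rate (N n)) \<and>
      (\<forall>x. (\<phi> has_real_derivative lap_reaction (F n) \<phi> x / c) (at x)) \<and>
      (\<forall>\<psi> \<psi>' x. \<psi> \<in> profiles (rate (N n)) \<longrightarrow> (\<forall>x. (\<psi> has_real_derivative \<psi>' x) (at x)) \<longrightarrow>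
        (\<forall>x. lap_reaction (F n) \<psi> x \<le> c * \<psi>' x) \<longrightarrow> \<phi> x \<le> \<psi> x)" for n
    using minimal_solution[OF F[of n]] by metis
  then obtain \<phi> where \<phi>0: "\<And>n. \<phi> n \<in> profiles (rate (N n))"
    and der: "\<And>n x. (\<phi> n has_real_derivative lap_reaction (F n) (\<phi> n) x / c) (at x)"
    and minimal: "\<And>n \<psi> \<psi>' x. \<psi> \<in> profiles (rate (N n)) \<Longrightarrow>
      (\<And>x. (\<psi> has_real_derivative \<psi>' x) (at x)) \<Longrightarrow>
      (\<And>x. lap_reaction (F n) \<psi> x \<le> c * \<psi>' x) \<Longrightarrow> \<phi> n x \<le> \<psi> x"
    by metis
  have der_bound: "\<bar>lap_reaction (F n) (\<phi> n) x / c\<bar> \<le> L" for n x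
    using lap_reaction_bound[OF \<phi>0 F_bound, where x = x] c_pos by (simp add: L_def divide_right_mono)
  have \<phi>L: "\<phi> n \<in> profiles L" for n
    using \<phi>0[of n] lipschitz_of_deriv_bounded[OF der der_bound, of n] by (simp add: profiles_def)
  have step: "\<phi> n x \<le> \<phi> (Suc n) x" for n x
  proof (rule minimal[OF profiles_weaken[OF \<phi>L L_rate] der])
    fix x
    have "F n (\<phi> (Suc n) x) (V (\<phi> (Suc n)) x) \<le> F (Suc n) (\<phi> (Suc n) x) (V (\<phi> (Suc n)) x)"
      by (intro F_mono profilesD(9)[OF \<phi>L] V_bounds[OF \<phi>L])
    then show "lap_reaction (F n) (\<phi> (Suc n)) x \<le> c * (lap_reaction (F (Suc n)) (\<phi> (Suc n)) x / c)"
      using c_pos by (simp add: lap_reaction_def)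
  qed
  have "\<exists>y. (\<lambda>n. \<phi> n x) \<longlonglongrightarrow> y" for x
    using incseq_convergent[of "\<lambda>n. \<phi> n x" K] step[of _ x] profilesD(3)[OF \<phi>L]
    by (metis incseq_SucI)
  then obtain \<psi> where \<psi>_lim: "\<And>x. (\<lambda>n. \<phi> n x) \<longlonglongrightarrow> \<psi> x" by metis
  have \<psi>: "\<psi> \<in> profiles L" by (rule profiles_limit[OF \<phi>L \<psi>_lim])
  let ?Q = "{0..K} \<times> {0..K}"
  have lap_lim: "(\<lambda>n. lap_reaction (F n) (\<phi> n) x) \<longlonglongrightarrow> lap_reaction f \<psi> x" for x
  proof -
    have V_lim: "(\<lambda>n. V (\<phi> n) x) \<longlonglongrightarrow> V \<psi> x"
      by (rule V_tendsto[OF \<phi>L \<psi>_lim])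
    have inQ: "(\<phi> n x, V (\<phi> n) x) \<in> ?Q" for n
      using profilesD(9)[OF \<phi>L] V_bounds[OF \<phi>L] by simp
    have "(\<lambda>n. (\<lambda>(u, v). f u v) (\<phi> n x, V (\<phi> n) x)) \<longlonglongrightarrow> (\<lambda>(u, v). f u v) (\<psi> x, V \<psi> x)"
      using profilesD(9)[OF \<psi>] V_bounds[OF \<psi>] inQ
      by (intro continuous_on_tendsto_compose[OF f tendsto_Pair[OF \<psi>_lim V_lim]]) auto
    \<comment> \<open>The arguments move with n, so uniform convergence of the nonlinearities is
      used here.\<close>
    moreover have "(\<lambda>n. F n (\<phi> n x) (V (\<phi> n) x) - f (\<phi> n x) (V (\<phi> n) x)) \<longlonglongrightarrow> 0"
    proof (rule LIMSEQ_I)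
      fix e :: real assume "e > 0"
      from uniform_limitD[OF lim this] obtain n0 where
        "\<And>n z. n \<ge> n0 \<Longrightarrow> z \<in> ?Q \<Longrightarrow> dist (case z of (u, v) \<Rightarrow> F n u v) (case z of (u, v) \<Rightarrow> f u v) < e"
        by (auto simp: eventually_sequentially)
      from this[OF _ inQ] show "\<exists>n0. \<forall>n\<ge>n0. norm (F n (\<phi> n x) (V (\<phi> n) x) - f (\<phi> n x) (V (\<phi> n) x) - 0) < e"
        by (auto simp: dist_real_def)
    qed
    ultimately have "(\<lambda>n. F n (\<phi> n x) (V (\<phi> n) x)) \<longlonglongrightarrow> f (\<psi> x) (V \<psi> x)"
      using tendsto_add by fastforce
    then show ?thesis
      unfolding lap_reaction_def dlap_def by (intro tendsto_intros \<psi>_lim)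
  qed
  \<comment> \<open>The derivatives are known to converge only pointwise. The uniform bound
    \<open>L\<close> allows dominated convergence in the integrated equation, and continuity of the
    limit integrand then returns a derivative.\<close>
  have FTC: "\<psi> t - \<psi> s = integral {s..t} (\<lambda>r. lap_reaction f \<psi> r / c)" if "s \<le> t" for s t
  proof -
    have I: "((\<lambda>r. lap_reaction (F n) (\<phi> n) r / c) has_integral \<phi> n t - \<phi> n s) {s..t}" for n
      by (intro fundamental_theorem_of_calculus[OF that])
         (simp add: has_real_derivative_iff_has_vector_derivative[symmetric] has_field_derivative_at_within der)
    have "(\<lambda>n. integral {s..t} (\<lambda>r. lap_reaction (F n) (\<phi> n) r / c))
        \<longlonglongrightarrow> integral {s..t} (\<lambda>r. lap_reaction f \<psi> r / c)"
    proof (rule dominated_convergence(2))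
      show "(\<lambda>r. lap_reaction (F n) (\<phi> n) r / c) integrable_on {s..t}" for n
        using I by blast
      show "(\<lambda>_. L) integrable_on {s..t}" by (rule integrable_const_ivl)
      show "norm (lap_reaction (F n) (\<phi> n) r / c) \<le> L" for n r
        using der_bound by (simp only: real_norm_def)
      show "(\<lambda>n. lap_reaction (F n) (\<phi> n) r / c) \<longlonglongrightarrow> lap_reaction f \<psi> r / c" for r
        by (intro tendsto_divide lap_lim tendsto_const) (use c_pos in simp)
    qed
    moreover have "integral {s..t} (\<lambda>r. lap_reaction (F n) (\<phi> n) r / c) = \<phi> n t - \<phi> n s" for n
      using I by (rule integral_unique)
    ultimately have "(\<lambda>n. \<phi> n t - \<phi> n s) \<longlonglongrightarrow> integral {s..t} (\<lambda>r. lap_reaction f \<psi> r / c)"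
      by simp
    then show ?thesis by (rule LIMSEQ_unique[OF tendsto_diff[OF \<psi>_lim \<psi>_lim]])
  qed
  have "(\<psi> has_real_derivative lap_reaction f \<psi> x / c) (at x)" for x
  proof -
    let ?I = "{x - 1..x + 1}"
    have x: "x \<in> ?I" by simp
    have "continuous_on ?I (\<lambda>r. lap_reaction f \<psi> r / c)"
      using lap_reaction_continuous[OF f \<psi>] c_pos by (intro continuous_intros) auto
    from DERIV_add[OF DERIV_const[of "\<psi> (x - 1)"] integral_has_real_derivative[OF this x]]
    have *: "((\<lambda>t. \<psi> (x - 1) + integral {x - 1..t} (\<lambda>r. lap_reaction f \<psi> r / c)) has_real_derivative
        lap_reaction f \<psi> x / c) (at x within ?I)"
      by (simp only: add_0)
    have "\<psi> (x - 1) + integral {x - 1..t} (\<lambda>r. lap_reaction f \<psi> r / c) = \<psi> t" if "t \<in> ?I" for t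
    proof -
      have "x - 1 \<le> t" using that by simp
      from FTC[OF this] show ?thesis by linarith
    qed
    then have "(\<psi> has_real_derivative lap_reaction f \<psi> x / c) (at x within ?I)"
      by (rule has_field_derivative_transform_within[OF * zero_less_one x])
    then show ?thesis
      by (simp add: at_within_Icc_at)
  qed
  then show thesis by (rule that[OF \<psi>])
qed

end

section \<open>Qualitative properties of the limit profile\<close>

lemma exp_decay_at_bot: "k > 0 \<Longrightarrow> ((\<lambda>x::real. exp (k * x)) \<longlongrightarrow> 0) at_bot"
  by (rule filterlim_compose[OF exp_at_bot filterlim_tendsto_pos_mult_at_bot[OF tendsto_const _ filterlim_ident]])

lemma mono_bounded_tendsto_at_top:
  fixes \<phi> :: "real \<Rightarrow> real"
  assumes "mono \<phi>" "\<And>x. \<phi> x \<le> K"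
  obtains y where "(\<phi> \<longlongrightarrow> y) at_top" "\<And>x. \<phi> x \<le> y" "y \<le> K"
proof
  have bdd: "bdd_above (range \<phi>)" using assms(2) by (intro bdd_aboveI2)
  show le: "\<phi> x \<le> (SUP x. \<phi> x)" for x by (intro cSUP_upper bdd) simp
  show "(SUP x. \<phi> x) \<le> K" by (intro cSUP_least assms(2)) simp
  show "(\<phi> \<longlongrightarrow> (SUP x. \<phi> x)) at_top"
  proof (rule increasing_tendsto)
    show "\<forall>\<^sub>F x in at_top. \<phi> x \<le> (SUP x. \<phi> x)" using le by simp
    fix y assume "y < (SUP x. \<phi> x)"
    then obtain z where "y < \<phi> z" using bdd by (auto simp: less_cSUP_iff)
    then show "\<forall>\<^sub>F x in at_top. y < \<phi> x"
      using monoD[OF assms(1), of z] unfolding eventually_at_top_linorder by (meson less_le_trans)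
  qed
qed

locale wave_profile = wave h d tau K a b c l \<mu> q x1 M p
  for h d tau K a b c l \<mu> q x1 M p +
  fixes f f1 :: "real \<Rightarrow> real \<Rightarrow> real" and \<phi> :: "real \<Rightarrow> real" and L :: real
  assumes f_cont: "continuous_on ({0..K} \<times> {0..K}) (\<lambda>(u, v). f u v)"
    and f_deriv: "\<And>u v. u \<in> {0..K} \<Longrightarrow> v \<in> {0..K} \<Longrightarrow>
      ((\<lambda>x. f x v) has_real_derivative f1 u v) (at u within {0..K})"
    and f_mono: "\<And>u v v'. u \<in> {0..K} \<Longrightarrow> v \<in> {0..K} \<Longrightarrow> v' \<in> {0..K} \<Longrightarrow> v \<le> v' \<Longrightarrow> f u v \<le> f u v'"
    and f_upper: "\<And>u v. u \<in> {0..K} \<Longrightarrow> v \<in> {0..K} \<Longrightarrow> f u v \<le> a * u + b * v"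
    and f_lower: "\<And>u v. u \<in> {0..K} \<Longrightarrow> v \<in> {0..K} \<Longrightarrow>
      a * u + b * v - M * (u + b * v) powr p \<le> f u v"
    and f_pos: "\<And>u. u \<in> {0<..<K} \<Longrightarrow> f u u > 0"
    and \<phi>: "\<phi> \<in> profiles L"
    and \<phi>_deriv: "\<And>x. (\<phi> has_real_derivative lap_reaction f \<phi> x / c) (at x)"
begin

lemmas \<phi>D = profilesD[OF \<phi>]

definition \<phi>' :: "real \<Rightarrow> real" where "\<phi>' x = lap_reaction f \<phi> x / c"

lemma der: "(\<phi> has_real_derivative \<phi>' x) (at x)"
  unfolding \<phi>'_def by (rule \<phi>_deriv)

lemma ode: "c * \<phi>' x = d * dlap \<phi> x + f (\<phi> x) (V \<phi> x)"
  using c_pos by (simp add: \<phi>'_def lap_reaction_def)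

section \<open>Exponential behaviour at minus infinity\<close>

lemma \<phi>_asymp: "((\<lambda>x. \<phi> x * exp (- l * x)) \<longlongrightarrow> 1) at_bot"
proof (rule real_tendsto_sandwich)
  show "\<forall>\<^sub>F x in at_bot. 1 - q * exp ((\<mu> - l) * x) \<le> \<phi> x * exp (- l * x)"
  proof (intro always_eventually allI)
    fix x
    have "1 - q * exp ((\<mu> - l) * x) = chi x * exp (- l * x)"
      by (simp add: chi_def algebra_simps exp_add[symmetric])
    also have "\<dots> \<le> \<phi> x * exp (- l * x)" by (intro mult_right_mono \<phi>D(4)) simp
    finally show "1 - q * exp ((\<mu> - l) * x) \<le> \<phi> x * exp (- l * x)" .
  qed
  show "\<forall>\<^sub>F x in at_bot. \<phi> x * exp (- l * x) \<le> 1"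
  proof (intro always_eventually allI)
    fix x
    have "\<phi> x * exp (- l * x) \<le> exp (l * x) * exp (- l * x)"
      by (intro mult_right_mono \<phi>D(5)) simp
    then show "\<phi> x * exp (- l * x) \<le> 1" by (simp add: exp_add[symmetric])
  qed
  have "((\<lambda>x. 1 - q * exp ((\<mu> - l) * x)) \<longlongrightarrow> 1 - q * 0) at_bot"
    using l_less by (intro tendsto_intros exp_decay_at_bot) simp
  then show "((\<lambda>x. 1 - q * exp ((\<mu> - l) * x)) \<longlongrightarrow> 1) at_bot" by simp
qed simp

lemma \<phi>_shift_asymp: "((\<lambda>x. \<phi> (x + r) * exp (- l * x)) \<longlongrightarrow> exp (l * r)) at_bot"
proof -
  have "filterlim (\<lambda>x::real. x + r) at_bot at_bot"
    unfolding filterlim_at_bot eventually_at_bot_linorder by (metis le_diff_eq)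
  from filterlim_compose[OF \<phi>_asymp this]
  have "((\<lambda>x. exp (l * r) * (\<phi> (x + r) * exp (- l * (x + r)))) \<longlongrightarrow> exp (l * r) * 1) at_bot"
    by (intro tendsto_intros)
  moreover have "exp (l * r) * (\<phi> (x + r) * exp (- l * (x + r))) = \<phi> (x + r) * exp (- l * x)" for x
    by (simp add: algebra_simps exp_add[symmetric])
  ultimately show ?thesis by (simp only: mult_1_right)
qed

lemma exp_cancel: "exp (l * x) * exp (- (l * x)) = 1"
  by (simp add: exp_add[symmetric])

lemma exp_diff_eq: "exp ((\<mu> - l) * x) = exp (\<mu> * x) * exp (- l * x)"
  by (simp add: exp_add[symmetric] algebra_simps)

lemma V_asymp: "((\<lambda>x. b * V \<phi> x * exp (- l * x)) \<longlongrightarrow> gam l) at_bot"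
proof (rule real_tendsto_sandwich)
  show "\<forall>\<^sub>F x in at_bot. gam l - q * gam \<mu> * exp ((\<mu> - l) * x) \<le> b * V \<phi> x * exp (- l * x)"
  proof (intro always_eventually allI)
    fix x
    have "gam l - q * gam \<mu> * exp ((\<mu> - l) * x)
        = (gam l * exp (l * x) - q * gam \<mu> * exp (\<mu> * x)) * exp (- l * x)"
      unfolding exp_diff_eq by (simp add: left_diff_distrib mult.assoc exp_cancel)
    also have "\<dots> \<le> b * V \<phi> x * exp (- l * x)" by (intro mult_right_mono V_lower[OF \<phi>]) simp
    finally show "gam l - q * gam \<mu> * exp ((\<mu> - l) * x) \<le> b * V \<phi> x * exp (- l * x)" .
  qed
  show "\<forall>\<^sub>F x in at_bot. b * V \<phi> x * exp (- l * x) \<le> gam l"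
  proof (intro always_eventually allI)
    fix x
    have "b * V \<phi> x * exp (- l * x) \<le> gam l * exp (l * x) * exp (- l * x)"
      by (intro mult_right_mono V_upper[OF \<phi>]) simp
    then show "b * V \<phi> x * exp (- l * x) \<le> gam l" by (simp add: mult.assoc exp_add[symmetric])
  qed
  have "((\<lambda>x. gam l - q * gam \<mu> * exp ((\<mu> - l) * x)) \<longlongrightarrow> gam l - q * gam \<mu> * 0) at_bot"
    using l_less by (intro tendsto_intros exp_decay_at_bot) simp
  then show "((\<lambda>x. gam l - q * gam \<mu> * exp ((\<mu> - l) * x)) \<longlongrightarrow> gam l) at_bot" by simp
qed simp

text \<open>For x \<le> 0 the defect from the linear part is at most a multiple of exp (\<mu> x),
  which is negligible against exp (l x).\<close>

lemma f_asymp: "((\<lambda>x. f (\<phi> x) (V \<phi> x) * exp (- l * x)) \<longlongrightarrow> a + gam l) at_bot"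
proof (rule real_tendsto_sandwich[rotated 3])
  let ?lin = "\<lambda>x. a * (\<phi> x * exp (- l * x)) + b * V \<phi> x * exp (- l * x)"
  let ?D = "charDelta d tau a b h c \<mu>"
  have lin: "(?lin \<longlongrightarrow> a * 1 + gam l) at_bot"
    by (intro tendsto_intros \<phi>_asymp V_asymp)
  then show "(?lin \<longlongrightarrow> a + gam l) at_bot" by simp
  have "((\<lambda>x. ?lin x - q * ?D * exp ((\<mu> - l) * x)) \<longlongrightarrow> (a * 1 + gam l) - q * ?D * 0) at_bot"
    using l_less by (intro tendsto_diff[OF lin] tendsto_intros exp_decay_at_bot) simp
  then show "((\<lambda>x. ?lin x - q * ?D * exp ((\<mu> - l) * x)) \<longlongrightarrow> a + gam l) at_bot" by simp
  show "\<forall>\<^sub>F x in at_bot. f (\<phi> x) (V \<phi> x) * exp (- l * x) \<le> ?lin x"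
  proof (intro always_eventually allI)
    fix x
    have "f (\<phi> x) (V \<phi> x) * exp (- l * x) \<le> (a * \<phi> x + b * V \<phi> x) * exp (- l * x)"
      by (intro mult_right_mono f_upper \<phi>D(9) V_bounds[OF \<phi>]) simp
    then show "f (\<phi> x) (V \<phi> x) * exp (- l * x) \<le> ?lin x" by (simp only: algebra_simps)
  qed
  show "\<forall>\<^sub>F x in at_bot. ?lin x - q * ?D * exp ((\<mu> - l) * x) \<le> f (\<phi> x) (V \<phi> x) * exp (- l * x)"
    using eventually_le_at_bot[of 0]
  proof eventually_elim
    case (elim x)
    have "a * \<phi> x + b * V \<phi> x - q * ?D * exp (\<mu> * x) \<le> f (\<phi> x) (V \<phi> x)"
      using power_term_bound[OF \<phi> elim \<phi>D(2,5)] f_lower[OF \<phi>D(9) V_bounds[OF \<phi>], of x x] by linarith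
    then have "(a * \<phi> x + b * V \<phi> x - q * ?D * exp (\<mu> * x)) * exp (- l * x)
        \<le> f (\<phi> x) (V \<phi> x) * exp (- l * x)"
      by (rule mult_right_mono) simp
    then show ?case unfolding exp_diff_eq by (simp only: algebra_simps)
  qed
qed

text \<open>The limit is read off the equation term by term, so the asymptotics of \<phi> need not
  be differentiated; Delta(l) = 0 identifies the result as l.\<close>

lemma deriv_asymp: "((\<lambda>x. \<phi>' x * exp (- l * x)) \<longlongrightarrow> l) at_bot"
proof -
  have "((\<lambda>x. (d * (\<phi> (x + 1) * exp (- l * x) - 2 * (\<phi> x * exp (- l * x)) + \<phi> (x + -1) * exp (- l * x))
      + f (\<phi> x) (V \<phi> x) * exp (- l * x)) / c) \<longlongrightarrow>
      (d * (exp (l * 1) - 2 * 1 + exp (l * -1)) + (a + gam l)) / c) at_bot"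
    using c_pos by (intro tendsto_intros \<phi>_asymp \<phi>_shift_asymp f_asymp) simp
  moreover have "(d * (exp (l * 1) - 2 * 1 + exp (l * -1)) + (a + gam l)) / c = l"
    using Delta_l c_pos by (simp add: charDelta_def gam_def field_simps)
  moreover have "(d * (\<phi> (x + 1) * exp (- l * x) - 2 * (\<phi> x * exp (- l * x)) + \<phi> (x + -1) * exp (- l * x))
      + f (\<phi> x) (V \<phi> x) * exp (- l * x)) / c = \<phi>' x * exp (- l * x)" for x
    by (simp add: \<phi>'_def lap_reaction_def dlap_def algebra_simps)
  ultimately show ?thesis by simp
qed

lemma tendsto_at_bot: "(\<phi> \<longlongrightarrow> 0) at_bot"
  by (rule real_tendsto_sandwich[OF _ _ tendsto_const exp_decay_at_bot[OF l_pos]])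
     (simp_all add: \<phi>D(2,5))

section \<open>Monotonicity and the limit at plus infinity\<close>

lemma deriv_nonneg: "0 \<le> \<phi>' x"
proof (rule ccontr)
  assume "\<not> 0 \<le> \<phi>' x"
  then obtain e where "e > 0" "\<And>h. 0 < h \<Longrightarrow> h < e \<Longrightarrow> \<phi> (x + h) < \<phi> x"
    using has_real_derivative_neg_dec_right[OF der[of x]] by auto
  from this(2)[of "e / 2"] this(1) monoD[OF \<phi>D(1), of x "x + e / 2"] show False by simp
qed

text \<open>The equation forces \<phi>' to tend to f(y, y) / c, where y is the limit of \<phi>. The
  barrier \<open>chi\<close>, positive left of \<open>x1\<close>, excludes y = 0, and 0 < y < K
  would keep the increments over unit intervals above a positive constant.\<close>

lemma tendsto_at_top: "(\<phi> \<longlongrightarrow> K) at_top"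
proof -
  obtain y where lim: "(\<phi> \<longlongrightarrow> y) at_top" and le: "\<And>x. \<phi> x \<le> y" and "y \<le> K"
    using mono_bounded_tendsto_at_top[OF \<phi>D(1,3)] by blast
  have "0 < chi (x1 - 1)" using l_less by (simp add: chi_factor)
  then have "0 < y" using \<phi>D(4)[of "x1 - 1"] le[of "x1 - 1"] by linarith
  have V_lim: "(V \<phi> \<longlongrightarrow> y) at_top"
  proof (rule tendsto_at_topI_sequentially)
    fix X :: "nat \<Rightarrow> real" assume X: "filterlim X at_top sequentially"
    have "(\<lambda>n. \<phi> (X n - z)) \<longlonglongrightarrow> y" for z
    proof -
      have "filterlim (\<lambda>n. - z + X n) at_top sequentially"
        by (rule filterlim_tendsto_add_at_top[OF tendsto_const X])
      then have "filterlim (\<lambda>n. X n - z) at_top sequentially" by simp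
      from filterlim_compose[OF lim this] show ?thesis .
    qed
    then have "(\<lambda>n. V \<phi> (X n)) \<longlonglongrightarrow> V (\<lambda>_. y) 0"
      by (intro V_tendsto[OF \<phi>])
    then show "(\<lambda>n. V \<phi> (X n)) \<longlonglongrightarrow> y" by (simp add: V_def conv_const)
  qed
  have shift: "((\<lambda>x. \<phi> (x + r)) \<longlongrightarrow> y) at_top" for r
  proof -
    have "filterlim (\<lambda>x::real. x + r) at_top at_top"
      by (subst add.commute) (rule filterlim_tendsto_add_at_top[OF tendsto_const filterlim_ident])
    from filterlim_compose[OF lim this] show ?thesis .
  qed
  have "((\<lambda>x. (\<lambda>(u, v). f u v) (\<phi> x, V \<phi> x)) \<longlongrightarrow> (\<lambda>(u, v). f u v) (y, y)) at_top"
    using \<phi>D(9) V_bounds[OF \<phi>] \<open>0 < y\<close> \<open>y \<le> K\<close>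
    by (intro continuous_on_tendsto_compose[OF f_cont tendsto_Pair[OF lim V_lim]]) auto
  then have "((\<lambda>x. (d * (\<phi> (x + 1) - 2 * \<phi> x + \<phi> (x + - 1)) + f (\<phi> x) (V \<phi> x)) / c) \<longlongrightarrow>
      (d * (y - 2 * y + y) + f y y) / c) at_top"
    using c_pos by (intro tendsto_intros lim shift) auto
  moreover have "(d * (\<phi> (x + 1) - 2 * \<phi> x + \<phi> (x + - 1)) + f (\<phi> x) (V \<phi> x)) / c = \<phi>' x" for x
    by (simp add: \<phi>'_def lap_reaction_def dlap_def)
  ultimately have der_lim: "(\<phi>' \<longlongrightarrow> f y y / c) at_top" by simp
  have "y = K"
  proof (rule ccontr)
    assume "y \<noteq> K"
    then have "f y y / c > 0" using f_pos[of y] \<open>0 < y\<close> \<open>y \<le> K\<close> c_pos by simp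
    then have "\<forall>\<^sub>F x in at_top. f y y / c / 2 < \<phi>' x"
      by (intro order_tendstoD(1)[OF der_lim]) simp
    then obtain X where X: "\<And>x. x \<ge> X \<Longrightarrow> f y y / c / 2 < \<phi>' x"
      by (auto simp: eventually_at_top_linorder)
    \<comment> \<open>The form \<open>x + 0\<close> allows \<open>shift\<close> to be used for both
      terms.\<close>
    have "f y y / c / 2 \<le> \<phi> (x + 1) - \<phi> (x + 0)" if "x \<ge> X" for x
    proof -
      obtain z where "x < z" "\<phi> (x + 1) - \<phi> x = (x + 1 - x) * \<phi>' z"
        using MVT2[of x "x + 1" \<phi> \<phi>'] der by auto
      then show ?thesis using X[of z] that by simp
    qed
    then have "\<forall>\<^sub>F x in at_top. f y y / c / 2 \<le> \<phi> (x + 1) - \<phi> (x + 0)"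
      by (auto simp: eventually_at_top_linorder)
    with tendsto_diff[OF shift shift] have "f y y / c / 2 \<le> y - y"
      by (rule tendsto_lowerbound) simp
    then show False using \<open>f y y / c > 0\<close> by simp
  qed
  then show ?thesis using lim by simp
qed

text \<open>Freezing the nonlocal argument at V phi x gives a differentiable function P that dominates
  c phi' to the left of x and touches it at x. If phi' x = 0, then P has derivative
  d (phi'(x+1) + phi'(x-1)) there, which must be nonpositive.\<close>
lemma deriv_zero_step:
  assumes zero: "\<phi>' x = 0"
  shows "\<phi>' (x - 1) = 0"
proof -
  define P where "P = (\<lambda>s. d * dlap \<phi> s + f (\<phi> s) (V \<phi> x))"
  have "((\<lambda>s. f (\<phi> s) (V \<phi> x)) has_real_derivative f1 (\<phi> x) (V \<phi> x) * \<phi>' x) (at x)"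
  proof -
    \<comment> \<open>\<open>f1\<close> is a derivative within \<open>{0..K}\<close>, hence
      one-sided at an end point, and \<phi> x has not yet been shown to be interior; so the chain
      rule is taken within \<open>range \<phi>\<close>.\<close>
    have "((\<lambda>u. f u (V \<phi> x)) has_real_derivative f1 (\<phi> x) (V \<phi> x)) (at (\<phi> x) within range \<phi>)"
      using \<phi>D(9) by (intro DERIV_subset[OF f_deriv[OF \<phi>D(9) V_bounds[OF \<phi>]]]) auto
    from DERIV_image_chain[OF this der] show ?thesis by (simp add: o_def)
  qed
  moreover have "((\<lambda>s. \<phi> (s + 1)) has_real_derivative \<phi>' (x + 1)) (at x)"
    using der[of "x + 1"] by (simp add: DERIV_shift)
  moreover have "((\<lambda>s. \<phi> (s + - 1)) has_real_derivative \<phi>' (x + - 1)) (at x)"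
    using der[of "x + - 1"] by (simp only: DERIV_shift)
  ultimately have P: "(P has_real_derivative d * (\<phi>' (x + 1) - 2 * \<phi>' x + \<phi>' (x - 1))
      + f1 (\<phi> x) (V \<phi> x) * \<phi>' x) (at x)"
    unfolding P_def dlap_def by (auto intro!: derivative_eq_intros der)
  have P_nonneg: "0 \<le> P s" if "s \<le> x" for s
  proof -
    have "0 \<le> c * \<phi>' s" using c_pos deriv_nonneg by simp
    also have "\<dots> \<le> P s"
      unfolding ode P_def using V_mono[OF \<phi> that] by (auto intro!: f_mono \<phi>D(9) V_bounds[OF \<phi>])
    finally show ?thesis .
  qed
  have P0: "P x = 0" using ode[of x] zero by (simp add: P_def)
  have "\<not> 0 < d * (\<phi>' (x + 1) - 2 * \<phi>' x + \<phi>' (x - 1)) + f1 (\<phi> x) (V \<phi> x) * \<phi>' x"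
  proof
    assume "0 < d * (\<phi>' (x + 1) - 2 * \<phi>' x + \<phi>' (x - 1)) + f1 (\<phi> x) (V \<phi> x) * \<phi>' x"
    from has_real_derivative_pos_inc_left[OF P this] obtain e where
      "e > 0" "\<And>h. 0 < h \<Longrightarrow> h < e \<Longrightarrow> P (x - h) < P x" by auto
    from this(2)[of "e / 2"] this(1) P_nonneg[of "x - e / 2"] P0 show False by simp
  qed
  then have "d * (\<phi>' (x + 1) + \<phi>' (x - 1)) \<le> 0" using zero by simp
  then have "\<phi>' (x + 1) + \<phi>' (x - 1) \<le> 0" using d_pos by (simp add: mult_le_0_iff)
  then show ?thesis using deriv_nonneg[of "x + 1"] deriv_nonneg[of "x - 1"] by linarith
qed

lemma deriv_pos: "0 < \<phi>' x"
proof (rule ccontr)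
  assume "\<not> 0 < \<phi>' x"
  then have "\<phi>' x = 0" using deriv_nonneg[of x] by simp
  then have zero: "\<phi>' (x - real n) = 0" for n
  proof (induction n)
    case (Suc n)
    then show ?case using deriv_zero_step[of "x - real n"] by (simp add: algebra_simps)
  qed simp
  have "\<forall>\<^sub>F y in at_bot. 0 < \<phi>' y * exp (- l * y)"
    by (rule order_tendstoD(1)[OF deriv_asymp l_pos])
  then obtain Y where Y: "\<And>y. y \<le> Y \<Longrightarrow> 0 < \<phi>' y * exp (- l * y)"
    by (auto simp: eventually_at_bot_linorder)
  obtain n where "x - Y \<le> real n" using real_arch_simple by blast
  then show False using Y[of "x - real n"] zero[of n] by simp
qed

lemma strict_bounds: "0 < \<phi> x" "\<phi> x < K"
proof -
  have strict: "\<phi> s < \<phi> t" if "s < t" for s t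
    using DERIV_pos_imp_increasing[OF that] der deriv_pos by blast
  show "0 < \<phi> x" using strict[of "x - 1" x] \<phi>D(2)[of "x - 1"] by simp
  show "\<phi> x < K" using strict[of x "x + 1"] \<phi>D(3)[of "x + 1"] by simp
qed

lemma deriv_eq: "deriv \<phi> x = \<phi>' x"
  by (rule DERIV_imp_deriv[OF der])

lemma travelling_wave: "travelling_wave d tau K f h c \<phi>"
proof -
  have "\<phi> differentiable at x" for x using der real_differentiable_def by blast
  then show ?thesis
    unfolding travelling_wave_def deriv_eq
    using ode tendsto_at_bot tendsto_at_top \<phi>D(2,3) by (simp add: V_def)
qed

end

section \<open>Inf-convolution\<close>

text \<open>Supplies the Lipschitz constant in u of the power term. The mean value theorem asks for
  the derivative only inside the interval, so s = 0 is covered.\<close>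

lemma powr_diff_le:
  fixes s t R p :: real
  assumes "0 \<le> s" "s \<le> t" "t \<le> R" "1 \<le> p"
  shows "t powr p - s powr p \<le> p * R powr (p - 1) * (t - s)"
proof (cases "s = t")
  case False
  then have "s < t" using assms by simp
  have cont: "continuous_on {s..t} (\<lambda>x. x powr p)"
    using assms by (intro continuous_on_powr' continuous_intros) auto
  have der: "((\<lambda>x. x powr p) has_real_derivative p * x powr (p - 1)) (at x)" if "s < x" for x
    using that assms by (intro has_real_derivative_powr) auto
  obtain z where z: "s < z" "z < t" "t powr p - s powr p = (t - s) * (p * z powr (p - 1))"
  proof -
    have "(\<lambda>x. x powr p) differentiable (at x)" if "s < x" for x
      using der[OF that] real_differentiable_def by blast
    then obtain D z where z: "s < z" "z < t" "((\<lambda>x. x powr p) has_real_derivative D) (at z)"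
      "t powr p - s powr p = (t - s) * D"
      using MVT[OF \<open>s < t\<close> cont] by blast
    moreover have "D = p * z powr (p - 1)" using DERIV_unique[OF z(3) der[OF z(1)]] .
    ultimately show thesis using that by blast
  qed
  have "z powr (p - 1) \<le> R powr (p - 1)"
    using z assms by (intro powr_mono2) auto
  then have "(t - s) * (p * z powr (p - 1)) \<le> (t - s) * (p * R powr (p - 1))"
    using assms by (intro mult_left_mono) auto
  then show ?thesis using z by (simp add: mult_ac)
qed simp

text \<open>The inf-convolution in the first variable: the largest minorant of f that is N-Lipschitz in u.\<close>
definition inf_conv :: "real \<Rightarrow> real \<Rightarrow> (real \<Rightarrow> real \<Rightarrow> real) \<Rightarrow> real \<Rightarrow> real \<Rightarrow> real" where
  "inf_conv K N f u v = (INF w\<in>{0..K}. f w v + N * \<bar>u - w\<bar>)"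

locale bounded_square =
  fixes K S :: real and f :: "real \<Rightarrow> real \<Rightarrow> real"
  assumes K_nonneg: "0 \<le> K"
    and f_bound: "\<And>u v. u \<in> {0..K} \<Longrightarrow> v \<in> {0..K} \<Longrightarrow> \<bar>f u v\<bar> \<le> S"
    and f_cont: "continuous_on ({0..K} \<times> {0..K}) (\<lambda>(u, v). f u v)"
begin

lemma inf_conv_lower:
  assumes "N \<ge> 0" "v \<in> {0..K}" "w \<in> {0..K}"
  shows "inf_conv K N f u v \<le> f w v + N * \<bar>u - w\<bar>"
  unfolding inf_conv_def
proof (rule cINF_lower[OF bdd_belowI2 assms(3)])
  fix w assume w: "w \<in> {0..K}"
  have "0 \<le> N * \<bar>u - w\<bar>" using assms(1) by simp
  then show "- S \<le> f w v + N * \<bar>u - w\<bar>" using f_bound[OF w assms(2)] by linarith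
qed

lemma inf_conv_greatest:
  assumes "\<And>w. w \<in> {0..K} \<Longrightarrow> g \<le> f w v + N * \<bar>u - w\<bar>"
  shows "g \<le> inf_conv K N f u v"
  unfolding inf_conv_def using K_nonneg by (intro cINF_greatest assms) auto

lemma inf_conv_le: "N \<ge> 0 \<Longrightarrow> u \<in> {0..K} \<Longrightarrow> v \<in> {0..K} \<Longrightarrow> inf_conv K N f u v \<le> f u v"
  using inf_conv_lower[of N v u u] by simp

lemma inf_conv_bound:
  assumes "N \<ge> 0" "u \<in> {0..K}" "v \<in> {0..K}"
  shows "\<bar>inf_conv K N f u v\<bar> \<le> S"
proof -
  have "- S \<le> inf_conv K N f u v"
  proof (rule inf_conv_greatest)
    fix w assume w: "w \<in> {0..K}"
    have "0 \<le> N * \<bar>u - w\<bar>" using assms(1) by simp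
    then show "- S \<le> f w v + N * \<bar>u - w\<bar>" using f_bound[OF w assms(3)] by linarith
  qed
  then show ?thesis using inf_conv_le[OF assms] f_bound[OF assms(2,3)] by linarith
qed

lemma inf_conv_lipschitz:
  assumes "N \<ge> 0" "v \<in> {0..K}"
  shows "inf_conv K N f u v \<le> inf_conv K N f u' v + N * \<bar>u - u'\<bar>"
proof -
  have "inf_conv K N f u v - N * \<bar>u - u'\<bar> \<le> inf_conv K N f u' v"
  proof (rule inf_conv_greatest)
    fix w assume w: "w \<in> {0..K}"
    have "N * \<bar>u - w\<bar> \<le> N * (\<bar>u' - w\<bar> + \<bar>u - u'\<bar>)"
      using assms(1) by (intro mult_left_mono) auto
    then show "inf_conv K N f u v - N * \<bar>u - u'\<bar> \<le> f w v + N * \<bar>u' - w\<bar>"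
      using inf_conv_lower[OF assms w, of u] by (simp add: distrib_left)
  qed
  then show ?thesis by simp
qed

lemma inf_conv_mono_rate:
  assumes "0 \<le> N" "N \<le> N'" "v \<in> {0..K}"
  shows "inf_conv K N f u v \<le> inf_conv K N' f u v"
proof (rule inf_conv_greatest)
  fix w assume w: "w \<in> {0..K}"
  have "N * \<bar>u - w\<bar> \<le> N' * \<bar>u - w\<bar>" using assms by (intro mult_right_mono) auto
  then show "inf_conv K N f u v \<le> f w v + N' * \<bar>u - w\<bar>"
    using inf_conv_lower[OF assms(1,3) w, of u] by linarith
qed

text \<open>With \<open>e = 0\<close> this is monotonicity in v; with small \<open>e\<close> it
  transfers a modulus of continuity in v that is uniform in w.\<close>

lemma inf_conv_snd:
  assumes "0 \<le> N" "v \<in> {0..K}" "\<And>w. w \<in> {0..K} \<Longrightarrow> f w v \<le> f w v' + e"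
  shows "inf_conv K N f u v \<le> inf_conv K N f u v' + e"
proof -
  have "inf_conv K N f u v - e \<le> inf_conv K N f u v'"
  proof (rule inf_conv_greatest)
    fix w assume w: "w \<in> {0..K}"
    show "inf_conv K N f u v - e \<le> f w v' + N * \<bar>u - w\<bar>"
      using inf_conv_lower[OF assms(1,2) w, of u] assms(3)[OF w] by linarith
  qed
  then show ?thesis by simp
qed

lemma uniform_modulus:
  assumes "e > 0"
  obtains \<delta> where "\<delta> > 0"
    "\<And>u v u' v'. u \<in> {0..K} \<Longrightarrow> v \<in> {0..K} \<Longrightarrow> u' \<in> {0..K} \<Longrightarrow> v' \<in> {0..K} \<Longrightarrow>
      \<bar>u - u'\<bar> + \<bar>v - v'\<bar> < \<delta> \<Longrightarrow> \<bar>f u v - f u' v'\<bar> < e"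
proof -
  have "uniformly_continuous_on ({0..K} \<times> {0..K}) (\<lambda>(u, v). f u v)"
    by (intro compact_uniformly_continuous f_cont compact_Times) auto
  then obtain \<delta> where \<delta>: "\<delta> > 0" "\<And>z z'. z \<in> {0..K} \<times> {0..K} \<Longrightarrow> z' \<in> {0..K} \<times> {0..K} \<Longrightarrow>
      dist z' z < \<delta> \<Longrightarrow> dist (case z' of (u, v) \<Rightarrow> f u v) (case z of (u, v) \<Rightarrow> f u v) < e"
    using assms unfolding uniformly_continuous_on_def by metis
  show thesis
  proof (rule that[OF \<delta>(1)])
    fix u v u' v' assume *: "u \<in> {0..K}" "v \<in> {0..K}" "u' \<in> {0..K}" "v' \<in> {0..K}"
      "\<bar>u - u'\<bar> + \<bar>v - v'\<bar> < \<delta>"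
    have "dist (u, v) (u', v') \<le> \<bar>u - u'\<bar> + \<bar>v - v'\<bar>"
      unfolding dist_Pair_Pair dist_real_def
      using sqrt_sum_squares_le_sum_abs[of "\<bar>u - u'\<bar>" "\<bar>v - v'\<bar>"] by simp
    then have "dist (u, v) (u', v') < \<delta>" using *(5) by linarith
    with \<delta>(2)[of "(u', v')" "(u, v)"] * show "\<bar>f u v - f u' v'\<bar> < e"
      by (simp add: dist_real_def)
  qed
qed

lemma inf_conv_continuous:
  assumes "N \<ge> 0"
  shows "continuous_on ({0..K} \<times> {0..K}) (\<lambda>(u, v). inf_conv K N f u v)"
  unfolding continuous_on_iff
proof (intro ballI allI impI)
  fix z :: "real \<times> real" and e :: real
  assume z: "z \<in> {0..K} \<times> {0..K}" and "e > 0"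
  obtain u v where uv: "z = (u, v)" "u \<in> {0..K}" "v \<in> {0..K}" using z by auto
  obtain \<delta> where \<delta>: "\<delta> > 0"
    "\<And>u v u' v'. u \<in> {0..K} \<Longrightarrow> v \<in> {0..K} \<Longrightarrow> u' \<in> {0..K} \<Longrightarrow> v' \<in> {0..K} \<Longrightarrow>
      \<bar>u - u'\<bar> + \<bar>v - v'\<bar> < \<delta> \<Longrightarrow> \<bar>f u v - f u' v'\<bar> < e / 2"
    using uniform_modulus[of "e / 2"] \<open>e > 0\<close> by auto
  \<comment> \<open>\<open>N + 1\<close> keeps \<open>r\<close> positive when N = 0.\<close>
  define r where "r = min \<delta> (e / 2 / (N + 1))"
  have r: "r > 0" using \<delta> \<open>e > 0\<close> assms by (simp add: r_def)
  show "\<exists>r>0. \<forall>z'\<in>{0..K} \<times> {0..K}. dist z' z < r \<longrightarrow>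
      dist (case z' of (u, v) \<Rightarrow> inf_conv K N f u v) (case z of (u, v) \<Rightarrow> inf_conv K N f u v) < e"
  proof (intro exI conjI ballI impI, rule r)
    fix z' assume z': "z' \<in> {0..K} \<times> {0..K}" and close: "dist z' z < r"
    obtain u' v' where uv': "z' = (u', v')" "u' \<in> {0..K}" "v' \<in> {0..K}" using z' by auto
    have "\<bar>u' - u\<bar> < r" "\<bar>v' - v\<bar> < r"
      using close dist_fst_le[of z' z] dist_snd_le[of z' z] by (auto simp: uv uv' dist_real_def)
    then have "\<bar>v' - v\<bar> < \<delta>" and "\<bar>u' - u\<bar> < e / 2 / (N + 1)" by (auto simp: r_def)
    then have "\<bar>u' - u\<bar> * (N + 1) < e / 2" using assms by (subst (asm) pos_less_divide_eq) auto
    then have Nu: "N * \<bar>u - u'\<bar> < e / 2"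
      unfolding distrib_left abs_minus_commute[of u' u] by (smt (verit) mult.commute)
    have osc: "\<bar>f w v - f w v'\<bar> < e / 2" if "w \<in> {0..K}" for w
      using \<open>\<bar>v' - v\<bar> < \<delta>\<close> that uv uv' by (intro \<delta>) (auto simp: abs_minus_commute)
    have "f w v \<le> f w v' + e / 2" "f w v' \<le> f w v + e / 2" if "w \<in> {0..K}" for w
      using osc[OF that] by linarith+
    then have "inf_conv K N f u' v \<le> inf_conv K N f u' v' + e / 2"
      "inf_conv K N f u' v' \<le> inf_conv K N f u' v + e / 2"
      by (auto intro: inf_conv_snd[OF assms uv(3)] inf_conv_snd[OF assms uv'(3)])
    moreover have "inf_conv K N f u v \<le> inf_conv K N f u' v + N * \<bar>u - u'\<bar>"
      "inf_conv K N f u' v \<le> inf_conv K N f u v + N * \<bar>u - u'\<bar>"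
      using inf_conv_lipschitz[OF assms uv(3), of u u'] inf_conv_lipschitz[OF assms uv(3), of u' u]
      by (auto simp: abs_minus_commute)
    ultimately show "dist (case z' of (u, v) \<Rightarrow> inf_conv K N f u v)
        (case z of (u, v) \<Rightarrow> inf_conv K N f u v) < e"
      using Nu by (simp add: uv uv' dist_real_def abs_less_iff)
  qed
qed

text \<open>Points w at distance at least \<delta> cost N \<delta> \<ge> 2 S, which no difference of
  values of f exceeds; nearer points change f by less than e / 2.\<close>

lemma inf_conv_uniform_limit:
  assumes "filterlim N at_top sequentially" "\<And>n. 0 \<le> N n"
  shows "uniform_limit ({0..K} \<times> {0..K}) (\<lambda>n (u, v). inf_conv K (N n) f u v) (\<lambda>(u, v). f u v) sequentially"
proof (rule uniform_limitI)
  fix e :: real assume "e > 0"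
  obtain \<delta> where \<delta>: "\<delta> > 0"
    "\<And>u v u' v'. u \<in> {0..K} \<Longrightarrow> v \<in> {0..K} \<Longrightarrow> u' \<in> {0..K} \<Longrightarrow> v' \<in> {0..K} \<Longrightarrow>
      \<bar>u - u'\<bar> + \<bar>v - v'\<bar> < \<delta> \<Longrightarrow> \<bar>f u v - f u' v'\<bar> < e / 2"
    using uniform_modulus[of "e / 2"] \<open>e > 0\<close> by auto
  have "\<forall>\<^sub>F n in sequentially. 2 * S / \<delta> \<le> N n"
    using assms(1) by (simp add: filterlim_at_top)
  then show "\<forall>\<^sub>F n in sequentially. \<forall>z\<in>{0..K} \<times> {0..K}.
      dist (case z of (u, v) \<Rightarrow> inf_conv K (N n) f u v) (case z of (u, v) \<Rightarrow> f u v) < e"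
  proof eventually_elim
    case (elim n)
    then have N: "2 * S \<le> N n * \<delta>" using \<delta>(1) by (simp add: pos_divide_le_eq)
    have "f u v - e / 2 \<le> inf_conv K (N n) f u v" if uv: "u \<in> {0..K}" "v \<in> {0..K}" for u v
    proof (rule inf_conv_greatest)
      fix w assume w: "w \<in> {0..K}"
      show "f u v - e / 2 \<le> f w v + N n * \<bar>u - w\<bar>"
      proof (cases "\<bar>u - w\<bar> < \<delta>")
        case True
        have "0 \<le> N n * \<bar>u - w\<bar>" using assms(2) by simp
        moreover have "\<bar>f u v - f w v\<bar> < e / 2" using \<delta>(2)[OF uv w uv(2)] True by simp
        ultimately show ?thesis by linarith
      next
        case False
        then have "N n * \<delta> \<le> N n * \<bar>u - w\<bar>" using assms(2) by (intro mult_left_mono) auto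
        then show ?thesis using N f_bound[OF uv] f_bound[OF w uv(2)] \<open>e > 0\<close> by linarith
      qed
    qed
    then have "\<bar>inf_conv K (N n) f u v - f u v\<bar> < e" if "u \<in> {0..K}" "v \<in> {0..K}" for u v
      using inf_conv_le[OF assms(2) that, of n] that \<open>e > 0\<close> by fastforce
    then show ?case by (auto simp: dist_real_def)
  qed
qed

end

lemma (in wave) profile_exists:
  assumes f_cont: "continuous_on ({0..K} \<times> {0..K}) (\<lambda>(u, v). f u v)"
    and f_mono: "\<And>u v v'. u \<in> {0..K} \<Longrightarrow> v \<in> {0..K} \<Longrightarrow> v' \<in> {0..K} \<Longrightarrow> v \<le> v' \<Longrightarrow> f u v \<le> f u v'"
    and f_upper: "\<And>u v. u \<in> {0..K} \<Longrightarrow> v \<in> {0..K} \<Longrightarrow> f u v \<le> a * u + b * v"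
    and f_lower: "\<And>u v. u \<in> {0..K} \<Longrightarrow> v \<in> {0..K} \<Longrightarrow>
      a * u + b * v - M * (u + b * v) powr p \<le> f u v"
    and f_K: "f K K \<le> 0" and p: "1 \<le> p"
  obtains \<phi> L where "\<phi> \<in> profiles L"
    "\<And>x. (\<phi> has_real_derivative lap_reaction f \<phi> x / c) (at x)"
proof -
  have "compact ((\<lambda>(u, v). f u v) ` ({0..K} \<times> {0..K}))"
    by (intro compact_continuous_image f_cont compact_Times) auto
  then have "bounded ((\<lambda>(u, v). f u v) ` ({0..K} \<times> {0..K}))" by (rule compact_imp_bounded)
  then obtain S where S: "\<And>u v. u \<in> {0..K} \<Longrightarrow> v \<in> {0..K} \<Longrightarrow> \<bar>f u v\<bar> \<le> S"
    unfolding bounded_iff by fastforce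
  interpret bounded_square K S f
    using K_pos S f_cont by unfold_locales auto
  have S0: "S \<ge> 0" using S[of 0 0] K_pos by simp
  define R where "R = p * (K + b * K) powr (p - 1)"
  have R: "R \<ge> 0" using p by (simp add: R_def)
  \<comment> \<open>Each summand serves a demand: |a| + M R is a Lipschitz constant in u of the
    lower barrier, S / K yields \<open>S \<le> N n * K\<close>, c l yields
    \<open>c * l \<le> N n + 2 * d\<close>, and n drives the regularisation to f.\<close>
  define N where "N = (\<lambda>n::nat. \<bar>a\<bar> + M * R + S / K + c * l + real n)"
  have MR: "0 \<le> M * R" using M_nonneg R by simp
  have SK: "0 \<le> S / K" using S0 K_pos by simp
  have cl: "0 \<le> c * l" using c_pos l_pos by simp
  have N: "0 \<le> N n" "0 \<le> N n + a" "c * l \<le> N n + 2 * d" "S / K \<le> N n" "\<bar>a\<bar> + M * R \<le> N n" for n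
    using MR SK cl d_pos unfolding N_def by linarith+
  \<comment> \<open>The barrier on the left lies below f and is Lipschitz in u with constant
    \<open>N n\<close>, so it also lies below the inf-convolution.\<close>
  have lower: "a * u + b * v - M * (u + b * v) powr p \<le> inf_conv K (N n) f u v"
    if uv: "u \<in> {0..K}" "v \<in> {0..K}" for u v n
  proof (rule inf_conv_greatest)
    fix w assume w: "w \<in> {0..K}"
    have bv: "0 \<le> b * v" "b * v \<le> b * K" using uv b_nonneg by (auto intro: mult_left_mono)
    have "(w + b * v) powr p - (u + b * v) powr p \<le> R * \<bar>u - w\<bar>"
    proof (cases "u \<le> w")
      case True
      then show ?thesis
        using powr_diff_le[of "u + b * v" "w + b * v" "K + b * K" p] bv uv w p by (simp add: R_def)
    next
      case False
      then have "(w + b * v) powr p \<le> (u + b * v) powr p"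
        using bv w p by (intro powr_mono2) auto
      moreover have "0 \<le> R * \<bar>u - w\<bar>" using R by simp
      ultimately show ?thesis by linarith
    qed
    from mult_left_mono[OF this M_nonneg]
    have "M * (w + b * v) powr p - M * (u + b * v) powr p \<le> M * R * \<bar>u - w\<bar>"
      by (simp add: algebra_simps)
    moreover have "a * u - a * w \<le> \<bar>a\<bar> * \<bar>u - w\<bar>"
      by (metis abs_ge_self abs_mult right_diff_distrib)
    moreover have "(\<bar>a\<bar> + M * R) * \<bar>u - w\<bar> \<le> N n * \<bar>u - w\<bar>"
      by (intro mult_right_mono N) simp
    ultimately show "a * u + b * v - M * (u + b * v) powr p \<le> f w v + N n * \<bar>u - w\<bar>"
      using f_lower[OF w uv(2)] by (simp add: distrib_right)
  qed
  have reaction: "reaction (N n) (inf_conv K (N n) f)" for n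
    unfolding reaction_def
  proof (intro conjI ballI impI)
    show "continuous_on ({0..K} \<times> {0..K}) (\<lambda>(u, v). inf_conv K (N n) f u v)"
      by (rule inf_conv_continuous[OF N(1)])
    show "inf_conv K (N n) f u v + N n * u \<le> inf_conv K (N n) f u' v + N n * u'"
      if "v \<in> {0..K}" "u \<le> u'" for u u' v
      using inf_conv_lipschitz[OF N(1) that(1), of n u u'] that(2) by (simp add: algebra_simps)
    show "inf_conv K (N n) f u v \<le> inf_conv K (N n) f u v'"
      if "v \<in> {0..K}" "v' \<in> {0..K}" "v \<le> v'" for u v v'
      using inf_conv_snd[OF N(1) that(1), of v' 0 n u] f_mono that by simp
    \<comment> \<open>The value of f at the origin would bound the infimum only from above; the sign
      comes from the lower barrier, which vanishes there.\<close>
    show "0 \<le> inf_conv K (N n) f 0 0"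
      using lower[of 0 0 n] K_pos p by simp
    show "inf_conv K (N n) f K K \<le> 0"
      using inf_conv_le[OF N(1), of K K n] f_K K_pos by simp
    show "inf_conv K (N n) f u v \<le> a * u + b * v" if "u \<in> {0..K}" "v \<in> {0..K}" for u v
      using inf_conv_le[OF N(1) that, of n] f_upper[OF that] by simp
  qed (use N lower in auto)
  have "filterlim N at_top sequentially"
    unfolding N_def by (rule filterlim_tendsto_add_at_top[OF tendsto_const filterlim_real_sequentially])
  note lim = inf_conv_uniform_limit[OF this N(1)]
  show thesis
  proof (rule solution_of_approximations[OF reaction _ _ _ f_cont lim])
    show "S \<le> N n * K" for n using N(4)[of n] K_pos by (simp add: pos_divide_le_eq)
    show "\<bar>inf_conv K (N n) f u v\<bar> \<le> S" if "u \<in> {0..K}" "v \<in> {0..K}" for n u v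
      by (rule inf_conv_bound[OF N(1) that])
    show "inf_conv K (N n) f u v \<le> inf_conv K (N (Suc n)) f u v"
      if "u \<in> {0..K}" "v \<in> {0..K}" for n u v
      using that(2) by (intro inf_conv_mono_rate N) (auto simp: N_def)
  qed (rule that)
qed

section \<open>The characteristic function\<close>

lemma exp_convex_combination:
  fixes s t u :: real
  assumes "0 < t" "t < 1"
  shows "exp ((1 - t) * x + t * y) \<le> (1 - t) * exp x + t * exp (y::real)"
  using convex_onD[OF exp_convex, of t x y] assms by simp

lemma convex_on_exp_linear: "convex S \<Longrightarrow> convex_on S (\<lambda>m::real. exp (k * m))"
proof (rule convex_onI)
  fix t x y :: real assume t: "0 < t" "t < 1"
  have "k * ((1 - t) *\<^sub>R x + t *\<^sub>R y) = (1 - t) * (k * x) + t * (k * y)"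
    by (simp add: algebra_simps)
  then show "exp (k * ((1 - t) *\<^sub>R x + t *\<^sub>R y)) \<le> (1 - t) * exp (k * x) + t * exp (k * y)"
    using exp_convex_combination[OF t] by simp
qed

text \<open>Applied to -Delta, this gives positivity between a point where Delta is nonnegative and
  one where it is positive.\<close>

lemma convex_on_neg_between:
  fixes g :: "real \<Rightarrow> real"
  assumes "convex_on S g" "x \<in> S" "z \<in> S" "x < y" "y < z" "g x \<le> 0" "g z < 0"
  shows "g y < 0"
proof -
  define t where "t = (y - x) / (z - x)"
  have t: "0 < t" "t < 1" using assms by (simp_all add: t_def field_simps)
  have "t * (z - x) = y - x" using assms by (simp add: t_def)
  then have "y = (1 - t) *\<^sub>R x + t *\<^sub>R z" by (simp add: algebra_simps)
  then have "g y \<le> (1 - t) * g x + t * g z"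
    using convex_onD[OF assms(1), of t x z] t assms by simp
  moreover have "(1 - t) * g x \<le> 0" using t assms by (simp add: mult_nonneg_nonpos)
  moreover have "t * g z < 0" using t assms by (simp add: mult_pos_neg)
  ultimately show ?thesis by linarith
qed

text \<open>On the negative half line, reflection and evenness of h turn the integrand into h(y) exp
  (m y); so the exponents m and -m both occur on the positive half line.\<close>

lemma exp_moment_integrable:
  fixes h :: "real \<Rightarrow> real"
  assumes nonneg: "\<And>x. h x \<ge> 0" and even: "\<And>x. h (- x) = h x"
    and moment: "\<And>l. \<bar>l\<bar> < R \<Longrightarrow> (\<lambda>x. h x * exp (l * x)) integrable_on {0..}"
    and m: "\<bar>m\<bar> < R"
  shows "(\<lambda>y. h y * exp (- m * y)) integrable_on UNIV"
proof -
  let ?g = "\<lambda>y. h y * exp (- m * y)"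
  have "(\<lambda>x. \<bar>- 1\<bar> *\<^sub>R ?g (- x)) absolutely_integrable_on {0..}"
    using moment[OF m] by (intro nonnegative_absolutely_integrable_1) (auto simp: even nonneg)
  then have "?g absolutely_integrable_on uminus ` {0..}"
    by (subst absolutely_integrable_change_of_variables_real[where h = "\<lambda>_. - 1"])
       (auto intro!: derivative_eq_intros)
  then have "?g absolutely_integrable_on {..0}" by simp
  then have "?g integrable_on {..0}" by (rule set_lebesgue_integral_eq_integral(1))
  moreover have "?g integrable_on {0..}" using moment[of "- m"] m by simp
  moreover have "negligible ({..0} \<inter> {0::real..})"
    by (rule negligible_subset[of "{0}"]) auto
  ultimately have "?g integrable_on ({..0} \<union> {0..})" by (intro integrable_Un)
  moreover have "{..0} \<union> {0..} = (UNIV :: real set)" by auto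
  ultimately show ?thesis by simp
qed

text \<open>The expression b exp (- m s) G(m) is the integral of b h(y) exp (- m (y + s)), which is convex
  in m. Hence Delta(c, .) is concave.\<close>
lemma charDelta_concave:
  assumes nonneg: "\<And>x. h x \<ge> 0" and b: "b \<ge> 0" and d: "d > 0" and S: "convex S"
    and moment: "\<And>m. m \<in> S \<Longrightarrow> (\<lambda>y. b * (h y * exp (- m * y))) integrable_on UNIV"
  shows "convex_on S (\<lambda>m. - charDelta d tau a b h c m)"
proof -
  define s where "s = c * tau"
  define \<Phi> where "\<Phi> = (\<lambda>m. integral UNIV (\<lambda>y. b * (h y * exp (- m * y)) * exp (- m * s)))"
  have int: "(\<lambda>y. b * (h y * exp (- m * y)) * exp (- m * s)) integrable_on UNIV" if "m \<in> S" for m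
    using moment[OF that] by (rule integrable_on_mult_left)
  have "convex_on S \<Phi>"
  proof (rule convex_onI[OF _ S])
    fix t m n :: real assume t: "0 < t" "t < 1" and mn: "m \<in> S" "n \<in> S"
    let ?r = "(1 - t) *\<^sub>R m + t *\<^sub>R n"
    let ?e = "\<lambda>m y. b * (h y * exp (- m * y)) * exp (- m * s)"
    have r: "?r \<in> S" using t mn S by (intro convexD_alt) auto
    have "\<Phi> ?r \<le> integral UNIV (\<lambda>y. (1 - t) * ?e m y + t * ?e n y)"
      unfolding \<Phi>_def
    proof (rule integral_le[OF int[OF r]])
      show "(\<lambda>y. (1 - t) * ?e m y + t * ?e n y) integrable_on UNIV"
        using int mn by (intro integrable_add integrable_on_mult_right) auto
      fix y
      have e: "?e k y = b * h y * exp (- k * (y + s))" for k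
        by (simp add: algebra_simps exp_add[symmetric])
      have "- ?r * (y + s) = (1 - t) * (- m * (y + s)) + t * (- n * (y + s))"
        by (simp add: algebra_simps)
      then have "exp (- ?r * (y + s)) \<le> (1 - t) * exp (- m * (y + s)) + t * exp (- n * (y + s))"
        using exp_convex_combination[OF t] by presburger
      from mult_left_mono[OF this, of "b * h y"]
      show "?e ?r y \<le> (1 - t) * ?e m y + t * ?e n y"
        unfolding e using b nonneg by (simp add: algebra_simps)
    qed
    also have "\<dots> = (1 - t) * \<Phi> m + t * \<Phi> n"
      unfolding \<Phi>_def using int mn
      by (subst integral_add) (auto intro!: integrable_on_mult_right simp del: mult_minus_left)
    finally show "\<Phi> ?r \<le> (1 - t) * \<Phi> m + t * \<Phi> n" .
  qed
  moreover have "convex_on S (\<lambda>m. d * (exp (1 * m) + exp (- 1 * m)))"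
    using d by (intro convex_on_cmul convex_on_add convex_on_exp_linear S) auto
  moreover have "convex_on S (\<lambda>m. (a - 2 * d) - c * m)"
    by (rule convex_onI[OF _ S]) (simp add: algebra_simps)
  ultimately have "convex_on S (\<lambda>m. \<Phi> m + (d * (exp (1 * m) + exp (- 1 * m)) + ((a - 2 * d) - c * m)))"
    by (intro convex_on_add)
  moreover have "\<Phi> m = b * exp (- m * c * tau) * kernelG h m" for m
    unfolding \<Phi>_def integral_mult_left integral_mult_right by (simp add: kernelG_def s_def mult.assoc)
  then have "\<Phi> m + (d * (exp (1 * m) + exp (- 1 * m)) + ((a - 2 * d) - c * m))
      = - charDelta d tau a b h c m" for m
    by (simp add: charDelta_def algebra_simps)
  ultimately show ?thesis by simp
qed

text \<open>c m grows strictly with c, while the delay factor does not grow. So the zero of Delta at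
  speed \<open>cstar\<close> becomes a positive value at every larger speed.\<close>

lemma charDelta_speed_less:
  assumes "\<And>x. h x \<ge> 0" "b \<ge> 0" "tau \<ge> 0" "c < c'" "0 < m"
    and moment: "(\<lambda>y. b * (h y * exp (- m * y))) integrable_on UNIV"
  shows "charDelta d tau a b h c m < charDelta d tau a b h c' m"
proof -
  have "0 \<le> integral UNIV (\<lambda>y. b * (h y * exp (- m * y)))"
    using moment by (rule integral_nonneg) (use assms in auto)
  then have G: "0 \<le> b * kernelG h m" by (simp add: kernelG_def)
  have "m * c * tau \<le> m * c' * tau"
    using assms by (intro mult_right_mono mult_left_mono) auto
  then have "exp (- m * c' * tau) * (b * kernelG h m) \<le> exp (- m * c * tau) * (b * kernelG h m)"
    using G by (intro mult_right_mono) auto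
  moreover have "c * m < c' * m" using assms by simp
  ultimately show ?thesis by (simp add: charDelta_def mult_ac)
qed

section \<open>Choice of the parameters and conclusion\<close>

theorem theorem3p1:
  fixes d tau K M \<sigma> cstar :: real
    and f f1 f2 :: "real \<Rightarrow> real \<Rightarrow> real"
    and h :: "real \<Rightarrow> real"
    and lambda0 :: ereal
  assumes d_pos: "d > 0" and tau_nonneg: "tau \<ge> 0" and K_pos: "K > 0"
    and pd1: "\<And>u v. u \<in> {0..K} \<Longrightarrow> v \<in> {0..K} \<Longrightarrow>
                ((\<lambda>x. f x v) has_real_derivative f1 u v) (at u within {0..K})"
    and pd2: "\<And>u v. u \<in> {0..K} \<Longrightarrow> v \<in> {0..K} \<Longrightarrow>
                ((\<lambda>y. f u y) has_real_derivative f2 u v) (at v within {0..K})"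
    (* (F1) *)
    and F1_cont: "continuous_on ({0..K} \<times> {0..K}) (\<lambda>(u, v). f u v)"
    and F1_zero: "f 0 0 = 0" "f K K = 0"
    and F1_pos: "\<And>u. u \<in> {0<..<K} \<Longrightarrow> f u u > 0"
    and F1_mono: "\<And>u v. u \<in> {0..K} \<Longrightarrow> v \<in> {0..K} \<Longrightarrow> f2 u v \<ge> 0"
    (* (F2) *)
    and F2_M: "M > 0" and F2_sigma: "0 < \<sigma>" "\<sigma> \<le> 1"
    and F2_bound: "\<And>u v. u \<in> {0..K} \<Longrightarrow> v \<in> {0..K} \<Longrightarrow>
         0 \<le> f1 0 0 * u + f2 0 0 * v - f u v \<and>
         f1 0 0 * u + f2 0 0 * v - f u v \<le> M * (u + v) powr (1 + \<sigma>)"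
    and F2_K: "f1 K K + f2 K K < 0"
    (* (H1) *)
    and H1_nonneg: "\<And>x. h x \<ge> 0"
    and H1_even: "\<And>x. h (- x) = h x"
    and H1_int: "h integrable_on UNIV"
    and H1_one: "integral UNIV h = 1"
    (* (H2) *)
    and H2_pos: "lambda0 > 0"
    and H2: "\<And>l. ereal l < lambda0 \<Longrightarrow> (\<lambda>x. h x * exp (l * x)) integrable_on {0..}"
    (* c^* is the unique speed with a double zero lambda^* in (0, lambda^+) *)
    and cstar_pos: "cstar > 0"
    and cstar_crit: "\<exists>ls. 0 < ls \<and> ereal ls < lambda_plus (f2 0 0) lambda0 \<and>
          charDelta d tau (f1 0 0) (f2 0 0) h cstar ls = 0 \<and>
          (charDelta d tau (f1 0 0) (f2 0 0) h cstar has_real_derivative 0) (at ls)"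
    and cstar_unique: "\<And>c' ls. c' > 0 \<Longrightarrow> 0 < ls \<Longrightarrow> ereal ls < lambda_plus (f2 0 0) lambda0 \<Longrightarrow>
          charDelta d tau (f1 0 0) (f2 0 0) h c' ls = 0 \<Longrightarrow>
          (charDelta d tau (f1 0 0) (f2 0 0) h c' has_real_derivative 0) (at ls) \<Longrightarrow> c' = cstar"
  shows "\<forall>c > cstar. \<exists>l \<phi>.
           \<comment> \<open>l = lambda_1(c): smallest positive zero of Delta(c, .)\<close>
           (0 < l \<and> ereal l < lambda_plus (f2 0 0) lambda0 \<and>
            charDelta d tau (f1 0 0) (f2 0 0) h c l = 0 \<and>
            (\<forall>m. 0 < m \<and> ereal m < lambda_plus (f2 0 0) lambda0 \<and>
                 charDelta d tau (f1 0 0) (f2 0 0) h c m = 0 \<longrightarrow> l \<le> m)) \<and>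
           travelling_wave d tau K f h c \<phi> \<and>
           (\<forall>\<xi>. 0 < \<phi> \<xi> \<and> \<phi> \<xi> < K \<and> deriv \<phi> \<xi> > 0) \<and>
           ((\<lambda>\<xi>. \<phi> \<xi> * exp (- l * \<xi>)) \<longlongrightarrow> 1) at_bot \<and>
           ((\<lambda>\<xi>. deriv \<phi> \<xi> * exp (- l * \<xi>)) \<longlongrightarrow> l) at_bot"
proof (intro allI impI)
  fix c assume c: "cstar < c"
  define a b p where "a = f1 0 0" and "b = f2 0 0" and "p = 1 + \<sigma>"
  let ?I = "{0..K}" and ?lp = "lambda_plus b lambda0"
  have b: "b \<ge> 0" using F1_mono[of 0 0] K_pos by (simp add: b_def)
  have c_pos: "c > 0" using c cstar_pos by simp
  have f_mono: "f u v \<le> f u v'" if "u \<in> ?I" "v \<in> ?I" "v' \<in> ?I" "v \<le> v'" for u v v'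
  proof (cases "v = v'")
    case False
    then have "v < v'" using that by simp
    moreover have "((\<lambda>y. f u y) has_derivative (*) (f2 u y)) (at y within {v..v'})"
      if "v \<le> y" "y \<le> v'" for y
      using DERIV_subset[OF pd2[of u y], of "{v..v'}"] that \<open>u \<in> ?I\<close> \<open>v \<in> ?I\<close> \<open>v' \<in> ?I\<close>
      by (auto simp: has_field_derivative_def)
    ultimately obtain z where "z \<in> {v<..<v'}" "f u v' - f u v = f2 u z * (v' - v)"
      using mvt_simple[of v v' "f u" "\<lambda>y. (*) (f2 u y)"] by auto
    moreover have "0 \<le> f2 u z" using F1_mono[of u z] that \<open>z \<in> {v<..<v'}\<close> by auto
    ultimately show ?thesis using \<open>v < v'\<close> by (smt (verit) mult_nonneg_nonneg)
  qed simp
  have f_upper: "f u v \<le> a * u + b * v" if "u \<in> ?I" "v \<in> ?I" for u v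
    using F2_bound[OF that] by (simp add: a_def b_def)
  \<comment> \<open>Converts u + v in (F2) into u + b v at the price of a constant: for b > 0, v is
    1 / b times b v. For b = 0 the bound is used at \<open>v0 = 0\<close> instead, which suffices
    because f is nondecreasing in v.\<close>
  define B where "B = (if b = 0 then 1 else max 1 (1 / b))"
  define M' where "M' = M * B powr p"
  have M': "M' \<ge> 0" using F2_M by (simp add: M'_def)
  have f_lower: "a * u + b * v - M' * (u + b * v) powr p \<le> f u v" if uv: "u \<in> ?I" "v \<in> ?I" for u v
  proof -
    define v0 where "v0 = (if b = 0 then 0 else v)"
    have v0: "v0 \<in> ?I" "v0 \<le> v" "b * v0 = b * v" using uv K_pos by (auto simp: v0_def)
    have B: "1 \<le> B" "v0 \<le> B * (b * v)"
    proof -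
      show "1 \<le> B" by (simp add: B_def)
      show "v0 \<le> B * (b * v)"
      proof (cases "b = 0")
        case False
        have "1 / b * (b * v) \<le> B * (b * v)"
          using False b uv by (intro mult_right_mono) (auto simp: B_def)
        then show ?thesis using False by (simp add: v0_def)
      qed (simp add: v0_def)
    qed
    have "u + v0 \<le> B * (u + b * v)"
      using B mult_right_mono[OF B(1), of u] uv by (simp add: distrib_left)
    then have "(u + v0) powr p \<le> (B * (u + b * v)) powr p"
      using uv v0 F2_sigma by (intro powr_mono2) (auto simp: p_def)
    also have "\<dots> = B powr p * (u + b * v) powr p"
      by (rule powr_mult)
    finally have "M * (u + v0) powr p \<le> M' * (u + b * v) powr p"
      using F2_M by (simp add: M'_def mult.assoc)
    moreover have "a * u + b * v0 - f u v0 \<le> M * (u + v0) powr p"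
      using F2_bound[OF uv(1) v0(1)] by (simp add: a_def b_def p_def)
    ultimately show ?thesis using f_mono[OF uv(1) v0(1) uv(2) v0(2)] v0(3) by linarith
  qed
  \<comment> \<open>This is the sign of -Delta(c, 0), which equals a + b.\<close>
  have ab: "a + b > 0"
  proof -
    have "0 < f (K / 2) (K / 2)" using F1_pos[of "K / 2"] K_pos by simp
    also have "\<dots> \<le> (a + b) * (K / 2)"
      using f_upper[of "K / 2" "K / 2"] K_pos by (simp add: algebra_simps)
    finally show ?thesis using K_pos by (simp add: zero_less_mult_iff)
  qed

  let ?D = "charDelta d tau a b h c"
  obtain ls where ls: "0 < ls" "ereal ls < ?lp" "charDelta d tau a b h cstar ls = 0"
    using cstar_crit by (auto simp: a_def b_def)
  \<comment> \<open>\<open>R\<close> leaves room beyond \<open>ls\<close>: convexity yields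
    continuity on the open interval \<open>S\<close>, and [0, ls] has to lie inside it.\<close>
  obtain R where R: "ls < R" "ereal R < ?lp"
    using ereal_dense2[OF ls(2)] by auto
  define S where "S = {- R<..<R}"
  have moment: "(\<lambda>y. b * (h y * exp (- m * y))) integrable_on UNIV" if "m \<in> S" for m
  proof (cases "b = 0")
    case False
    then have "?lp = lambda0" using b by (simp add: lambda_plus_def)
    have "(\<lambda>y. h y * exp (- m * y)) integrable_on UNIV"
    proof (rule exp_moment_integrable[where h = h and R = R, OF H1_nonneg H1_even])
      show "\<bar>m\<bar> < R" using that by (auto simp: S_def)
      show "(\<lambda>x. h x * exp (l * x)) integrable_on {0..}" if "\<bar>l\<bar> < R" for l
      proof (rule H2)
        have "ereal l < ereal R" using that by simp
        then show "ereal l < lambda0" using R(2) \<open>?lp = lambda0\<close> by (metis less_trans)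
      qed
    qed
    then show ?thesis by (rule integrable_on_mult_right)
  qed (simp add: integrable_0)
  have in_S: "m \<in> S" if "0 \<le> m" "m \<le> ls" for m using that R(1) ls(1) by (simp add: S_def)
  have concave: "convex_on S (\<lambda>m. - ?D m)"
    by (rule charDelta_concave[where h = h, OF H1_nonneg b d_pos _ moment]) (simp add: S_def)
  have D0: "?D 0 < 0"
    using ab H1_one by (simp add: charDelta_def kernelG_def)
  have D_ls: "?D ls > 0"
    using charDelta_speed_less[where h = h and d = d and a = a, OF H1_nonneg b tau_nonneg c ls(1) moment[OF in_S]] ls(1,3) by simp
  have "continuous_on S (\<lambda>m. - (- ?D m))"
    by (intro continuous_on_minus convex_on_continuous[OF _ concave]) (simp_all add: S_def)
  then have "continuous_on {0..ls} ?D"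
    using in_S by (auto elim: continuous_on_subset)
  then obtain l where l0: "0 \<le> l" "l \<le> ls" "?D l = 0"
    using IVT'[of ?D 0 0 ls] D0 D_ls ls(1) by (auto simp: less_imp_le)
  have l: "0 < l" "l < ls"
    using l0 D0 D_ls by (auto simp: less_le)
  \<comment> \<open>By concavity Delta is positive from any point where it is nonnegative up to
    \<open>ls\<close>. A zero before l would thus give Delta(l) > 0, so l is the smallest one, and
    the same fact makes Delta(\<mu>) > 0.\<close>
  have D_pos: "0 < ?D y" if "0 \<le> x" "x < y" "y < ls" "0 \<le> ?D x" for x y
    using convex_on_neg_between[OF concave in_S[of x] in_S[of ls], of y] that ls(1) D_ls by simp
  have minimal: "l \<le> m" if "0 < m" "?D m = 0" for m
    using D_pos[of m l] that l l0(3) by (intro leI notI) auto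

  have "l < min ls (p * l)" using l F2_sigma by (simp add: p_def)
  then obtain \<mu> where "l < \<mu>" "\<mu> < min ls (p * l)" using dense by blast
  then have \<mu>: "l < \<mu>" "\<mu> < ls" "\<mu> \<le> p * l" by simp_all
  have D\<mu>: "0 < ?D \<mu>" using D_pos[of l \<mu>] l l0 \<mu> by simp
  define A where "A = M' * (1 + b * exp (- l * c * tau) * kernelG h l) powr p"
  have A: "A \<ge> 0" using M' by (simp add: A_def)
  \<comment> \<open>The three bounds give, in order, \<open>x1 \<le> 0\<close>,
    \<open>exp (l * x1) \<le> K\<close> and \<open>A / ?D \<mu> + 1 \<le> q\<close>; the summand 1
    keeps the argument of the logarithm positive when A = 0.\<close>
  define x1 where "x1 = min 0 (min (ln K / l) (- (ln (A / ?D \<mu> + 1) / (\<mu> - l))))"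
  define q where "q = exp ((l - \<mu>) * x1)"
  have x1: "x1 \<le> 0" "x1 \<le> ln K / l" "x1 \<le> - (ln (A / ?D \<mu> + 1) / (\<mu> - l))"
    by (simp_all add: x1_def)
  have "l * x1 \<le> ln K" using x1(2) l by (simp add: pos_le_divide_eq mult.commute)
  then have x1K: "exp (l * x1) \<le> K" using K_pos by (simp add: ln_ge_iff)
  have "ln (A / ?D \<mu> + 1) / (\<mu> - l) \<le> - x1" using x1(3) by linarith
  then have "ln (A / ?D \<mu> + 1) \<le> (l - \<mu>) * x1"
    using \<mu>(1) by (simp add: pos_divide_le_eq algebra_simps)
  moreover have "0 < A / ?D \<mu> + 1" using A D\<mu> by (simp add: add_nonneg_pos)
  ultimately have "A / ?D \<mu> + 1 \<le> q" unfolding q_def by (metis exp_le_cancel_iff exp_ln)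
  then have "A / ?D \<mu> \<le> q" by simp
  then have q: "A \<le> q * ?D \<mu>" using D\<mu> by (simp add: pos_divide_le_eq)
  interpret wave h d tau K a b c l \<mu> q x1 M' p
    using H1_nonneg H1_int H1_one d_pos K_pos b c_pos l \<mu> M' moment[OF in_S] l0 q x1 x1K
    by unfold_locales (auto simp: A_def q_def)
  have p1: "1 \<le> p" using F2_sigma by (simp add: p_def)
  obtain \<phi> L where \<phi>: "\<phi> \<in> profiles L"
    "\<And>x. (\<phi> has_real_derivative lap_reaction f \<phi> x / c) (at x)"
    using profile_exists[OF F1_cont f_mono f_upper f_lower _ p1] F1_zero by auto
  interpret wave_profile h d tau K a b c l \<mu> q x1 M' p f f1 \<phi> L
    using F1_cont pd1 f_mono f_upper f_lower F1_pos \<phi> by unfold_locales auto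
  have l_lp: "ereal l < ?lp" using l(2) ls(2) by (metis ereal_less_eq(3) less_imp_le order_le_less_trans)
  show "\<exists>l \<phi>. (0 < l \<and> ereal l < lambda_plus (f2 0 0) lambda0 \<and>
            charDelta d tau (f1 0 0) (f2 0 0) h c l = 0 \<and>
            (\<forall>m. 0 < m \<and> ereal m < lambda_plus (f2 0 0) lambda0 \<and>
                 charDelta d tau (f1 0 0) (f2 0 0) h c m = 0 \<longrightarrow> l \<le> m)) \<and>
           travelling_wave d tau K f h c \<phi> \<and>
           (\<forall>\<xi>. 0 < \<phi> \<xi> \<and> \<phi> \<xi> < K \<and> deriv \<phi> \<xi> > 0) \<and>
           ((\<lambda>\<xi>. \<phi> \<xi> * exp (- l * \<xi>)) \<longlongrightarrow> 1) at_bot \<and>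
           ((\<lambda>\<xi>. deriv \<phi> \<xi> * exp (- l * \<xi>)) \<longlongrightarrow> l) at_bot"
    unfolding a_def[symmetric] b_def[symmetric]
  proof (intro exI conjI allI impI)
    show "((\<lambda>\<xi>. \<phi> \<xi> * exp (- l * \<xi>)) \<longlongrightarrow> 1) at_bot" by (rule \<phi>_asymp)
    show "((\<lambda>\<xi>. deriv \<phi> \<xi> * exp (- l * \<xi>)) \<longlongrightarrow> l) at_bot"
      unfolding deriv_eq by (rule deriv_asymp)
  qed (use l l_lp l0 minimal travelling_wave strict_bounds deriv_pos deriv_eq in auto)
qed

end
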